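(* Let $\mathbb{H}_1,\ldots,\mathbb{H}_n$ be complex Hilbert spaces and, for $i=1,\ldots,n$, let $A_i\in\mathbb{B}(\mathbb{H}_i,\mathbb{H}_1)$ and $B_i\in\mathbb{B}(\mathbb{H}_1,\mathbb{H}_i)$. Then $$r\left(\sum_{i=1}^n A_iB_i\right)\le\omega\left([\gamma_{ij}]_{i,j=1}^n\right),$$ where $[\gamma_{ij}]_{i,j=1}^n$ is the $n\times n$ scalar matrix with entries $$\gamma_{ij}=\begin{cases}\omega(B_iA_i) & \text{if } i=j,\\ \sqrt{\omega\left(|B_iA_j|+\mathrm{i}|A_i^*B_j^*|\right)\,\omega\left(|A_j^*B_i^*|+\mathrm{i}|B_jA_i|\right)+\|B_iA_j\|\,\|B_jA_i\|+\omega(B_jA_iB_iA_j)} & \text{if } i<j,\\ 0 & \text{if } i>j.\end{cases}$$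
   Context: $\mathbb{B}(\mathbb{H}_1,\mathbb{H}_2)$ is the set of bounded linear operators from the complex Hilbert space $\mathbb{H}_1$ to the complex Hilbert space $\mathbb{H}_2$, and $\mathbb{B}(\mathbb{H})=\mathbb{B}(\mathbb{H},\mathbb{H})$. $\|\cdot\|$ is the usual operator norm. For a bounded operator $T$ between Hilbert spaces, $T^*$ is its adjoint and $|T|=(T^*T)^{1/2}$. For $T\in\mathbb{B}(\mathbb{H})$, the numerical radius is $\omega(T)=\sup\{|\langle Tx,x\rangle|:x\in\mathbb{H},\|x\|=1\}$ and the spectral radius is $r(T)=\sup\{|\lambda|:\lambda \text{ is in the spectrum of } T\}$. For an $n\times n$ scalar matrix the numerical radius is taken as an operator on $\mathbb{C}^n$ with the standard inner product. $\mathrm{i}$ (roman) is the imaginary unit, while $i,j$ (italic) are indices. *)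

theory Defs
  imports "Jordan_Normal_Form.VS_Connect"
begin

text \<open>
  A complex inner product space is a \<open>module\<close> record over the complex numbers together with an
  inner product, linear in its first argument.  Carriers are sets, so that a family
  \<open>H :: nat \<Rightarrow> 'a chilbert\<close> can consist of entirely unrelated spaces; one element type suffices,
  since finitely many spaces embed in the sum of their element types.  As always in HOL-Algebra,
  the fields \<open>mult\<close> and \<open>one\<close> inherited from \<open>ring\<close> are irrelevant for modules.
\<close>

record 'a chilbert = "(complex, 'a) module" +
  cinner :: "'a \<Rightarrow> 'a \<Rightarrow> complex"

definition cnorm :: "('a, 'm) chilbert_scheme \<Rightarrow> 'a \<Rightarrow> real" where
  "cnorm H x = sqrt (Re (cinner H x x))"

locale complex_hilbert_space = vectorspace "class_ring :: complex ring" H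
  for H :: "('a, 'm) chilbert_scheme" (structure) +
  assumes cinner_add_left: "\<lbrakk>x \<in> carrier H; y \<in> carrier H; z \<in> carrier H\<rbrakk> \<Longrightarrow>
      cinner H (x \<oplus> y) z = cinner H x z + cinner H y z"
    and cinner_smult_left: "\<lbrakk>x \<in> carrier H; y \<in> carrier H\<rbrakk> \<Longrightarrow>
      cinner H (c \<odot> x) y = c * cinner H x y"
    and cinner_commute: "\<lbrakk>x \<in> carrier H; y \<in> carrier H\<rbrakk> \<Longrightarrow>
      cinner H x y = cnj (cinner H y x)"
    and cinner_nonneg: "x \<in> carrier H \<Longrightarrow> 0 \<le> Re (cinner H x x)"
    and cinner_eq_zero: "\<lbrakk>x \<in> carrier H; cinner H x x = 0\<rbrakk> \<Longrightarrow> x = \<zero>"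
    and complete: "\<lbrakk>\<And>k :: nat. s k \<in> carrier H;
        \<And>e :: real. 0 < e \<Longrightarrow> \<exists>N. \<forall>k\<ge>N. \<forall>l\<ge>N. cnorm H (s k \<ominus> s l) < e\<rbrakk> \<Longrightarrow>
      \<exists>x\<in>carrier H. (\<lambda>k. cnorm H (s k \<ominus> x)) \<longlonglongrightarrow> 0"

text \<open>
  Operators are HOL functions of which only the values on the carrier of the domain matter; all
  notions below depend on these values alone.
\<close>

definition bounded_ops ::
  "('a, 'm) chilbert_scheme \<Rightarrow> ('b, 'k) chilbert_scheme \<Rightarrow> ('a \<Rightarrow> 'b) set" where
  "bounded_ops H K = {T \<in> LinearCombinations.module_hom (class_ring :: complex ring) H K.
     \<exists>c. \<forall>x\<in>carrier H. cnorm K (T x) \<le> c * cnorm H x}"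

definition op_norm ::
  "('a, 'm) chilbert_scheme \<Rightarrow> ('b, 'k) chilbert_scheme \<Rightarrow> ('a \<Rightarrow> 'b) \<Rightarrow> real" where
  "op_norm H K T = Sup {cnorm K (T x) | x. x \<in> carrier H \<and> cnorm H x \<le> 1}"

definition adjoint_op ::
  "('a, 'm) chilbert_scheme \<Rightarrow> ('b, 'k) chilbert_scheme \<Rightarrow> ('a \<Rightarrow> 'b) \<Rightarrow> 'b \<Rightarrow> 'a" where
  "adjoint_op H K T y =
     (THE x. x \<in> carrier H \<and> (\<forall>z\<in>carrier H. cinner K (T z) y = cinner H z x))"

definition positive_op :: "('a, 'm) chilbert_scheme \<Rightarrow> ('a \<Rightarrow> 'a) \<Rightarrow> bool" where
  "positive_op H S \<longleftrightarrow> S \<in> bounded_ops H H \<and>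
     (\<forall>x\<in>carrier H. cinner H (S x) x \<in> \<real> \<and> 0 \<le> Re (cinner H (S x) x))"

text \<open>
  The square root of a positive operator is unique on the carrier, but arbitrary elsewhere, hence
  \<open>SOME\<close> rather than \<open>THE\<close>.
\<close>

definition sqrt_op :: "('a, 'm) chilbert_scheme \<Rightarrow> ('a \<Rightarrow> 'a) \<Rightarrow> 'a \<Rightarrow> 'a" where
  "sqrt_op H P = (SOME S. positive_op H S \<and> (\<forall>x\<in>carrier H. S (S x) = P x))"

definition abs_op ::
  "('a, 'm) chilbert_scheme \<Rightarrow> ('b, 'k) chilbert_scheme \<Rightarrow> ('a \<Rightarrow> 'b) \<Rightarrow> 'a \<Rightarrow> 'a" where
  "abs_op H K T = sqrt_op H (adjoint_op H K T \<circ> T)"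

definition op_spectrum :: "('a, 'm) chilbert_scheme \<Rightarrow> ('a \<Rightarrow> 'a) \<Rightarrow> complex set" where
  "op_spectrum H T = {z. \<not> (\<exists>S\<in>bounded_ops H H. \<forall>x\<in>carrier H.
     S (T x \<ominus>\<^bsub>H\<^esub> z \<odot>\<^bsub>H\<^esub> x) = x \<and> T (S x) \<ominus>\<^bsub>H\<^esub> z \<odot>\<^bsub>H\<^esub> S x = x)}"

text \<open>
  Both radii are suprema in \<open>[0, \<infinity>)\<close>.  Inserting \<open>0\<close> only matters on the zero space, where there
  are no unit vectors and the spectrum is empty: \<open>Sup {}\<close> is unspecified for real numbers, whereas
  both radii of the zero operator on the zero space are meant to be \<open>0\<close>.
\<close>

definition op_spectral_radius :: "('a, 'm) chilbert_scheme \<Rightarrow> ('a \<Rightarrow> 'a) \<Rightarrow> real" where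
  "op_spectral_radius H T = Sup (insert 0 {cmod z | z. z \<in> op_spectrum H T})"

definition numerical_radius :: "('a, 'm) chilbert_scheme \<Rightarrow> ('a \<Rightarrow> 'a) \<Rightarrow> real" where
  "numerical_radius H T =
     Sup (insert 0 {cmod (cinner H (T x) x) | x. x \<in> carrier H \<and> cnorm H x = 1})"

text \<open>\<open>\<complex>\<^sup>n\<close> with the standard inner product.\<close>

definition Cn :: "nat \<Rightarrow> complex vec chilbert" where
  "Cn n = module.extend (module_vec TYPE(complex) n) \<lparr>cinner = (\<lambda>v w. v \<bullet>c w)\<rparr>"

definition mat_numerical_radius :: "nat \<Rightarrow> complex mat \<Rightarrow> real" where
  "mat_numerical_radius n M = numerical_radius (Cn n) (\<lambda>v. M *\<^sub>v v)"

text \<open>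
  Indices start at \<open>0\<close>: \<open>H 0\<close> is the common space, with \<open>A i \<in> bounded_ops (H i) (H 0)\<close> and
  \<open>B i \<in> bounded_ops (H 0) (H i)\<close>.  Accordingly the operators composed in \<open>gamma\<close> run as follows:
  \<open>B\<^sub>i A\<^sub>j : H\<^sub>j \<rightarrow> H\<^sub>i\<close>,  \<open>B\<^sub>j A\<^sub>i : H\<^sub>i \<rightarrow> H\<^sub>j\<close>,  \<open>A\<^sub>i\<^sup>* B\<^sub>j\<^sup>* : H\<^sub>j \<rightarrow> H\<^sub>i\<close>,  \<open>A\<^sub>j\<^sup>* B\<^sub>i\<^sup>* : H\<^sub>i \<rightarrow> H\<^sub>j\<close>.
\<close>

definition gamma ::
  "(nat \<Rightarrow> 'a chilbert) \<Rightarrow> (nat \<Rightarrow> 'a \<Rightarrow> 'a) \<Rightarrow> (nat \<Rightarrow> 'a \<Rightarrow> 'a) \<Rightarrow> nat \<Rightarrow> nat \<Rightarrow> real" where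
  "gamma H A B i j =
    (let As = (\<lambda>k. adjoint_op (H k) (H 0) (A k));
         Bs = (\<lambda>k. adjoint_op (H 0) (H k) (B k))
     in if i = j then numerical_radius (H i) (B i \<circ> A i)
        else if i < j then
          sqrt (numerical_radius (H j)
                  (\<lambda>x. abs_op (H j) (H i) (B i \<circ> A j) x
                     \<oplus>\<^bsub>H j\<^esub> \<i> \<odot>\<^bsub>H j\<^esub> abs_op (H j) (H i) (As i \<circ> Bs j) x)
              * numerical_radius (H i)
                  (\<lambda>x. abs_op (H i) (H j) (As j \<circ> Bs i) x
                     \<oplus>\<^bsub>H i\<^esub> \<i> \<odot>\<^bsub>H i\<^esub> abs_op (H i) (H j) (B j \<circ> A i) x)
              + op_norm (H j) (H i) (B i \<circ> A j) * op_norm (H i) (H j) (B j \<circ> A i)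
              + numerical_radius (H j) (B j \<circ> A i \<circ> B i \<circ> A j))
        else 0)"

end

theory Submission
  imports Defs
begin

text \<open>
  Let \<open>z\<close> exceed the numerical radius \<open>w\<close> of \<open>[\<gamma>\<^sub>i\<^sub>j]\<close> in modulus, and let \<open>x \<in> H\<^sub>0\<close>, \<open>x\<^sub>i = B\<^sub>i x\<close>.  By the
  definition of \<open>\<gamma>\<close>, the form \<open>\<Sum>\<^sub>i\<^sub>j \<bar>\<langle>B\<^sub>i A\<^sub>j x\<^sub>j, x\<^sub>i\<rangle>\<bar>\<close> is at most
  \<open>\<Sum>\<^sub>i\<^sub>j \<gamma>\<^sub>i\<^sub>j \<parallel>x\<^sub>i\<parallel> \<parallel>x\<^sub>j\<parallel> \<le> w \<Sum>\<^sub>i \<parallel>x\<^sub>i\<parallel>\<^sup>2\<close>, which makes \<open>\<Sum>\<^sub>i A\<^sub>i B\<^sub>i - z\<close> bounded below.  The form does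
  not change on passing to adjoints, so the adjoint is bounded below as well and \<open>z\<close> is not in the
  spectrum.  The off-diagonal estimate for \<open>T = B\<^sub>i A\<^sub>j\<close> and \<open>S = B\<^sub>j A\<^sub>i\<close> expands the square of
  \<open>\<bar>\<langle>T x, y\<rangle>\<bar> + \<bar>\<langle>S y, x\<rangle>\<bar>\<close>: the squares are bounded by the mixed Schwarz inequality
  \<open>\<bar>\<langle>T x, y\<rangle>\<bar>\<^sup>2 \<le> \<langle>|T| x, x\<rangle> \<langle>|T\<^sup>*| y, y\<rangle>\<close>, the mixed term by Buzano's inequality.
\<close>

section \<open>Inner products and positive operators\<close>

text \<open>The usual route compares the spectrum of the sum with that of the operator matrix of the
  products \<open>B i A j\<close> on the direct sum of the \<open>H i\<close>. Here the direct sum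
  stays implicit: the components \<open>B i x\<close> play its vectors, and lower bounds for the sum
  minus z and for its adjoint give the resolvent directly. Apart from square roots, existence has
  one source, the minimisation in \<open>Lax_Milgram\<close>: it yields the adjoints, the inverse,
  and the solution of (|T| + e) a = x that replaces the polar decomposition in the mixed Schwarz
  inequality. In the entries above the diagonal, <|T| x, x> and <|S*| x, x> are the real and
  imaginary part of one form, whence the radii of |T| + i |S*| and its counterpart; Buzano's
  inequality contributes the two norms and the radius of S T. The matrix is upper triangular because
  its form at a real vector only sees the sum of the entries at (i, j) and (j, i), so both orders
  are charged to the position with i < j.\<close>

lemma bounded_opsD:
  assumes "T \<in> bounded_ops H K"
  shows "x \<in> carrier H \<Longrightarrow> T x \<in> carrier K"
    and "x \<in> carrier H \<Longrightarrow> y \<in> carrier H \<Longrightarrow> T (x \<oplus>\<^bsub>H\<^esub> y) = T x \<oplus>\<^bsub>K\<^esub> T y"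
    and "x \<in> carrier H \<Longrightarrow> T (c \<odot>\<^bsub>H\<^esub> x) = c \<odot>\<^bsub>K\<^esub> T x"
  using assms by (auto simp: bounded_ops_def LinearCombinations.module_hom_def class_ring_simps)

lemma bounded_opsI:
  assumes "\<And>x. x \<in> carrier H \<Longrightarrow> T x \<in> carrier K"
    and "\<And>x y. x \<in> carrier H \<Longrightarrow> y \<in> carrier H \<Longrightarrow> T (x \<oplus>\<^bsub>H\<^esub> y) = T x \<oplus>\<^bsub>K\<^esub> T y"
    and "\<And>x c. x \<in> carrier H \<Longrightarrow> T (c \<odot>\<^bsub>H\<^esub> x) = c \<odot>\<^bsub>K\<^esub> T x"
    and "\<And>x. x \<in> carrier H \<Longrightarrow> cnorm K (T x) \<le> c * cnorm H x"
  shows "T \<in> bounded_ops H K"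
  using assms unfolding bounded_ops_def LinearCombinations.module_hom_def by fast

lemma ident_bounded_op [simp]: "(\<lambda>x. x) \<in> bounded_ops H H"
  by (rule bounded_opsI[where c = 1]) auto

context complex_hilbert_space
begin

lemma smult_carrier [simp]: "x \<in> carrier H \<Longrightarrow> c \<odot> x \<in> carrier H"
  by (rule smult_closed) (auto simp: class_ring_simps)

lemma cinner_add_right [simp]:
  "x \<in> carrier H \<Longrightarrow> y \<in> carrier H \<Longrightarrow> z \<in> carrier H \<Longrightarrow>
    cinner H z (x \<oplus> y) = cinner H z x + cinner H z y"
  by (subst (1 2 3) cinner_commute) (auto simp: cinner_add_left)

lemma cinner_smult_right [simp]:
  "x \<in> carrier H \<Longrightarrow> y \<in> carrier H \<Longrightarrow> cinner H y (c \<odot> x) = cnj c * cinner H y x"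
  by (subst (1 2) cinner_commute) (auto simp: cinner_smult_left)

lemmas [simp] = cinner_add_left cinner_smult_left

lemma cinner_zero_left [simp]: "x \<in> carrier H \<Longrightarrow> cinner H \<zero> x = 0"
  using cinner_add_left[of \<zero> \<zero> x] by simp

lemma cinner_zero_right [simp]: "x \<in> carrier H \<Longrightarrow> cinner H x \<zero> = 0"
  using cinner_add_right[of \<zero> \<zero> x] by simp

lemma cinner_minus_left [simp]:
  "x \<in> carrier H \<Longrightarrow> y \<in> carrier H \<Longrightarrow> cinner H (\<ominus> x) y = - cinner H x y"
  using cinner_add_left[of x "\<ominus> x" y] by (simp add: r_neg add_eq_0_iff)

lemma cinner_minus_right [simp]:
  "x \<in> carrier H \<Longrightarrow> y \<in> carrier H \<Longrightarrow> cinner H y (\<ominus> x) = - cinner H y x"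
  using cinner_add_right[of x "\<ominus> x" y] by (simp add: r_neg add_eq_0_iff)

lemma cinner_diff_left [simp]:
  "x \<in> carrier H \<Longrightarrow> y \<in> carrier H \<Longrightarrow> z \<in> carrier H \<Longrightarrow>
    cinner H (x \<ominus> y) z = cinner H x z - cinner H y z"
  by (simp add: minus_eq)

lemma cinner_diff_right [simp]:
  "x \<in> carrier H \<Longrightarrow> y \<in> carrier H \<Longrightarrow> z \<in> carrier H \<Longrightarrow>
    cinner H z (x \<ominus> y) = cinner H z x - cinner H z y"
  by (simp add: minus_eq)

text \<open>Equations between vectors are proved throughout by pairing both sides with an arbitrary
  vector, which trades module arithmetic for arithmetic in the complex numbers.\<close>

lemma cinner_ext:
  assumes "x \<in> carrier H" "y \<in> carrier H"
    and "\<And>z. z \<in> carrier H \<Longrightarrow> cinner H z x = cinner H z y"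
  shows "x = y"
proof -
  \<comment> \<open>Only the second argument is expanded, so that the hypothesis applies with z the
    difference itself.\<close>
  have "cinner H (x \<ominus> y) (x \<ominus> y) = 0"
    using assms by (simp add: minus_closed del: cinner_diff_left)
  then have "x \<ominus> y = \<zero>" using assms cinner_eq_zero minus_closed by blast
  then have "x \<oplus> \<ominus> y \<oplus> y = y" using assms(2) by (simp add: minus_eq)
  then show ?thesis using assms(1,2) by (simp add: a_assoc l_neg)
qed

lemma diff_self [simp]: "x \<in> carrier H \<Longrightarrow> x \<ominus> x = \<zero>"
  by (rule cinner_ext) auto

lemma cinner_ext_left:
  assumes "x \<in> carrier H" "y \<in> carrier H"
    and "\<And>z. z \<in> carrier H \<Longrightarrow> cinner H x z = cinner H y z"
  shows "x = y"
  by (rule cinner_ext) (use assms cinner_commute in metis)+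

lemma cinner_self: "x \<in> carrier H \<Longrightarrow> cinner H x x = complex_of_real ((cnorm H x)\<^sup>2)"
  using cinner_commute[of x x] cinner_nonneg[of x]
  by (auto simp: cnorm_def complex_eq_iff)

lemma cnorm_nonneg [simp]: "x \<in> carrier H \<Longrightarrow> 0 \<le> cnorm H x"
  using cinner_nonneg by (simp add: cnorm_def)

lemma cnorm_eq_zero [simp]: "x \<in> carrier H \<Longrightarrow> cnorm H x = 0 \<longleftrightarrow> x = \<zero>"
  using cinner_self[of x] cinner_eq_zero[of x] by (auto simp: cnorm_def)

lemma Re_cinner_self: "x \<in> carrier H \<Longrightarrow> Re (cinner H x x) = (cnorm H x)\<^sup>2"
  by (simp add: cinner_self)

lemma cnorm_smult [simp]: "x \<in> carrier H \<Longrightarrow> cnorm H (c \<odot> x) = cmod c * cnorm H x"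
proof -
  assume x: "x \<in> carrier H"
  then have "complex_of_real ((cnorm H (c \<odot> x))\<^sup>2) = c * cnj c * complex_of_real ((cnorm H x)\<^sup>2)"
    by (simp add: cinner_self[symmetric] del: of_real_power)
  also have "\<dots> = complex_of_real ((cmod c * cnorm H x)\<^sup>2)"
    by (simp add: complex_norm_square[symmetric] power_mult_distrib)
  finally have "(cnorm H (c \<odot> x))\<^sup>2 = (cmod c * cnorm H x)\<^sup>2"
    using of_real_eq_iff by blast
  then show ?thesis using x by (simp add: power2_eq_iff_nonneg)
qed

end

section \<open>Positive forms and their Cauchy-Schwarz inequality\<close>

locale positive_operator = complex_hilbert_space +
  fixes S
  assumes positive: "positive_op H S"
begin

lemma bounded: "S \<in> bounded_ops H H"
  using positive by (simp add: positive_op_def)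

lemmas closed [simp] = bounded_opsD(1)[OF bounded]
  and add [simp] = bounded_opsD(2)[OF bounded]
  and smult [simp] = bounded_opsD(3)[OF bounded]

lemma form_nonneg: "x \<in> carrier H \<Longrightarrow> 0 \<le> Re (cinner H (S x) x)"
  and form_real: "x \<in> carrier H \<Longrightarrow> Im (cinner H (S x) x) = 0"
  using positive by (auto simp: positive_op_def complex_is_Real_iff)

lemma form_eq: "x \<in> carrier H \<Longrightarrow> cinner H (S x) x = complex_of_real (Re (cinner H (S x) x))"
  by (simp add: complex_eq_iff form_real)

text \<open>Polarisation: the form is real at x + y and at x + i y, which settles the imaginary and
  the real part of <S x, y> - conj <S y, x> in turn.\<close>

lemma selfadjoint:
  assumes x: "x \<in> carrier H" and y: "y \<in> carrier H"
  shows "cinner H (S x) y = cinner H x (S y)"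
proof -
  have a: "Im (cinner H (S x) y + cinner H (S y) x) = 0"
    using form_real[of "x \<oplus> y"] x y by (simp add: form_real)
  have b: "Re (cinner H (S y) x - cinner H (S x) y) = 0"
    using form_real[of "x \<oplus> \<i> \<odot> y"] x y by (simp add: form_real)
  have "cinner H (S x) y = cnj (cinner H (S y) x)"
    using a b by (auto simp: complex_eq_iff)
  then show ?thesis using x y cinner_commute by (metis closed)
qed

lemma form_Cauchy_Schwarz:
  assumes x: "x \<in> carrier H" and y: "y \<in> carrier H"
  shows "(cmod (cinner H (S x) y))\<^sup>2 \<le> Re (cinner H (S x) x) * Re (cinner H (S y) y)"
proof -
  let ?p = "Re (cinner H (S x) x)" and ?q = "Re (cinner H (S y) y)"
  define c where "c = cinner H (S x) y"
  have c': "cinner H (S y) x = cnj c"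
    using selfadjoint[OF x y] cinner_commute x y unfolding c_def by (metis closed)
  have quad: "0 \<le> ?p * s\<^sup>2 - 2 * (cmod c)\<^sup>2 * s + (cmod c)\<^sup>2 * ?q" for s :: real
  proof -
    \<comment> \<open>The coefficient -c turns both cross terms into the real number -s
      |c|^2.\<close>
    let ?v = "(of_real s) \<odot> x \<oplus> (- c) \<odot> y"
    have "0 \<le> Re (cinner H (S ?v) ?v)" using x y by (intro form_nonneg) auto
    also have "cinner H (S ?v) ?v = of_real (s\<^sup>2) * cinner H (S x) x - of_real s * (2 * (c * cnj c))
        + (c * cnj c) * cinner H (S y) y"
      using x y by (simp add: c' c_def[symmetric] algebra_simps power2_eq_square)
    also have "\<dots> = of_real (?p * s\<^sup>2 - 2 * (cmod c)\<^sup>2 * s + (cmod c)\<^sup>2 * ?q)"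
      unfolding complex_norm_square[symmetric]
      by (subst form_eq[OF x], subst form_eq[OF y]) (simp add: algebra_simps)
    finally show ?thesis by simp
  qed
  show ?thesis
  proof (cases "c = 0")
    case True
    then show ?thesis using form_nonneg x y by (simp add: c_def)
  next
    case False
    then have cp: "(cmod c)\<^sup>2 > 0" by simp
    have p: "?p \<ge> 0" and q: "?q \<ge> 0" using form_nonneg x y by auto
    \<comment> \<open>The form may be degenerate. With p = 0 the quadratic becomes linear in s with
      negative slope and cannot stay nonnegative.\<close>
    have "?p \<noteq> 0"
    proof
      assume "?p = 0"
      then have "0 \<le> (cmod c)\<^sup>2 * (?q - 2 * s)" for s using quad[of s] by (simp add: algebra_simps)
      then have "0 \<le> ?q - 2 * s" for s using cp by (metis mult_le_0_iff linorder_not_le less_le_not_le mult_pos_neg)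
      from this[of "?q + 1"] q show False by simp
    qed
    with p have p: "?p > 0" by simp
    \<comment> \<open>The value s = |c|^2 / p is the minimum point of the quadratic.\<close>
    have "0 \<le> ?p * ((cmod c)\<^sup>2 / ?p)\<^sup>2 - 2 * (cmod c)\<^sup>2 * ((cmod c)\<^sup>2 / ?p) + (cmod c)\<^sup>2 * ?q"
      by (rule quad)
    also have "\<dots> = (cmod c)\<^sup>2 * (?q - (cmod c)\<^sup>2 / ?p)"
      using p by (simp add: field_simps power2_eq_square)
    finally have "0 \<le> ?q - (cmod c)\<^sup>2 / ?p" using cp by (metis mult_pos_neg linorder_not_le)
    then show ?thesis using p by (simp add: c_def field_simps)
  qed
qed

end

context complex_hilbert_space
begin

lemma positive_ident: "positive_op H (\<lambda>x. x)"
  by (auto simp: positive_op_def complex_is_Real_iff cinner_self cinner_nonneg)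

lemma Cauchy_Schwarz:
  assumes "x \<in> carrier H" "y \<in> carrier H"
  shows "cmod (cinner H x y) \<le> cnorm H x * cnorm H y"
proof -
  have "positive_operator H (\<lambda>x. x)" by unfold_locales (rule positive_ident)
  from positive_operator.form_Cauchy_Schwarz[OF this assms] show ?thesis
    using assms
    by (simp add: Re_cinner_self power_mult_distrib[symmetric] power2_le_iff_abs_le)
qed

lemma cnorm_add_sq:
  assumes "x \<in> carrier H" "y \<in> carrier H"
  shows "(cnorm H (x \<oplus> y))\<^sup>2 = (cnorm H x)\<^sup>2 + 2 * Re (cinner H x y) + (cnorm H y)\<^sup>2"
  using assms cinner_commute[of x y] by (simp add: Re_cinner_self[symmetric])

lemma cnorm_triangle:
  assumes "x \<in> carrier H" "y \<in> carrier H"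
  shows "cnorm H (x \<oplus> y) \<le> cnorm H x + cnorm H y"
proof (rule power2_le_imp_le)
  have "Re (cinner H x y) \<le> cnorm H x * cnorm H y"
    using Cauchy_Schwarz[OF assms] complex_Re_le_cmod order_trans by blast
  then show "(cnorm H (x \<oplus> y))\<^sup>2 \<le> (cnorm H x + cnorm H y)\<^sup>2"
    using assms by (simp add: cnorm_add_sq power2_sum)
qed (use assms in auto)

lemma uminus_eq_smult: "x \<in> carrier H \<Longrightarrow> \<ominus> x = (- 1) \<odot> x"
  by (rule cinner_ext) auto

lemma cnorm_uminus [simp]: "x \<in> carrier H \<Longrightarrow> cnorm H (\<ominus> x) = cnorm H x"
  by (simp add: uminus_eq_smult)

lemma cnorm_triangle_diff:
  assumes "x \<in> carrier H" "y \<in> carrier H"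
  shows "cnorm H (x \<ominus> y) \<le> cnorm H x + cnorm H y"
  using cnorm_triangle[of x "\<ominus> y"] assms by (simp add: minus_eq)

lemma cnorm_diff_commute:
  assumes "x \<in> carrier H" "y \<in> carrier H"
  shows "cnorm H (x \<ominus> y) = cnorm H (y \<ominus> x)"
proof -
  have "x \<ominus> y = \<ominus> (y \<ominus> x)" using assms by (intro cinner_ext) auto
  then show ?thesis using assms by simp
qed

lemma cnorm_diff_triangle:
  assumes "x \<in> carrier H" "y \<in> carrier H" "z \<in> carrier H"
  shows "cnorm H (x \<ominus> z) \<le> cnorm H (x \<ominus> y) + cnorm H (y \<ominus> z)"
proof -
  have "x \<ominus> z = (x \<ominus> y) \<oplus> (y \<ominus> z)" using assms by (intro cinner_ext) auto
  then show ?thesis using assms by (simp add: cnorm_triangle)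
qed

lemma cnorm_zero [simp]: "cnorm H \<zero> = 0"
  by simp

lemma zero_bounded_op: "(\<lambda>x. \<zero>) \<in> bounded_ops K H"
  by (rule bounded_opsI[where c = 0]) (auto intro!: cinner_ext)

end

section \<open>Riesz representation, adjoints and inverses\<close>

locale hilbert_operator = H: complex_hilbert_space H + K: complex_hilbert_space K
  for H :: "('a, 'm) chilbert_scheme" and K :: "('b, 'k) chilbert_scheme" +
  fixes T
  assumes bounded: "T \<in> bounded_ops H K"
begin

lemmas closed [simp] = bounded_opsD(1)[OF bounded]
  and add [simp] = bounded_opsD(2)[OF bounded]
  and smult [simp] = bounded_opsD(3)[OF bounded]

lemma uminus [simp]: "x \<in> carrier H \<Longrightarrow> T (\<ominus>\<^bsub>H\<^esub> x) = \<ominus>\<^bsub>K\<^esub> T x"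
  by (simp add: H.uminus_eq_smult K.uminus_eq_smult)

lemma diff [simp]:
  "x \<in> carrier H \<Longrightarrow> y \<in> carrier H \<Longrightarrow> T (x \<ominus>\<^bsub>H\<^esub> y) = T x \<ominus>\<^bsub>K\<^esub> T y"
  by (simp add: H.minus_eq K.minus_eq)

text \<open>The constant is raised to at least 1, so that later arguments may divide by it.\<close>

lemma bound:
  obtains c where "0 < c" "\<And>x. x \<in> carrier H \<Longrightarrow> cnorm K (T x) \<le> c * cnorm H x"
proof -
  obtain c where c: "\<forall>x\<in>carrier H. cnorm K (T x) \<le> c * cnorm H x"
    using bounded by (auto simp: bounded_ops_def)
  show ?thesis
  proof (rule that[of "max c 1"])
    fix x assume x: "x \<in> carrier H"
    then have "c * cnorm H x \<le> max c 1 * cnorm H x" by (intro mult_right_mono) auto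
    then show "cnorm K (T x) \<le> max c 1 * cnorm H x" using c x by force
  qed simp
qed

end

section \<open>Minimising a coercive quadratic functional\<close>

context positive_operator
begin

sublocale hilbert_operator H H S
  by unfold_locales (rule bounded)

text \<open>A minimiser of J x = <S x, x> - 2 Re (f x) solves the equation. With S the identity this
  is the Riesz representation; with f = <., u> it makes a coercive S surjective.\<close>

lemma Lax_Milgram:
  assumes "0 < c" and coercive: "\<And>x. x \<in> carrier H \<Longrightarrow> c * (cnorm H x)\<^sup>2 \<le> Re (cinner H (S x) x)"
    and f_add: "\<And>x y. x \<in> carrier H \<Longrightarrow> y \<in> carrier H \<Longrightarrow> f (x \<oplus> y) = f x + f y"
    and f_smult: "\<And>x a. x \<in> carrier H \<Longrightarrow> f (a \<odot> x) = a * f x"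
    and f_bound: "\<And>x. x \<in> carrier H \<Longrightarrow> cmod (f x) \<le> M * cnorm H x"
  shows "\<exists>x\<in>carrier H. \<forall>z\<in>carrier H. f z = cinner H z (S x)"
proof -
  define q where "q x = Re (cinner H (S x) x)" for x
  define J where "J x = q x - 2 * Re (f x)" for x
  define m where "m = Inf (J ` carrier H)"
  \<comment> \<open>Complete the square in c t^2 - 2 M t at t = ||x||.\<close>
  have "- (M\<^sup>2 / c) \<le> J x" if x: "x \<in> carrier H" for x
  proof -
    have "0 \<le> (c * cnorm H x - M)\<^sup>2 / c" using \<open>0 < c\<close> by simp
    also have "\<dots> = c * (cnorm H x)\<^sup>2 - 2 * (M * cnorm H x) + M\<^sup>2 / c"
      using \<open>0 < c\<close> by (simp add: power2_diff power_mult_distrib field_simps power2_eq_square)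
    also have "\<dots> \<le> J x + M\<^sup>2 / c"
      using coercive[OF x] f_bound[OF x] complex_Re_le_cmod[of "f x"] unfolding J_def q_def by linarith
    finally show ?thesis by simp
  qed
  then have "bdd_below (J ` carrier H)" by (auto intro!: bdd_belowI)
  then have m_le: "m \<le> J x" if "x \<in> carrier H" for x
    unfolding m_def using that by (auto intro: cInf_lower)
  have "\<exists>x\<in>carrier H. J x < m + e" if "0 < e" for e
    using cInf_lessD[of "J ` carrier H" "m + e"] that zero_closed unfolding m_def by fastforce
  then have "\<forall>k. \<exists>x\<in>carrier H. J x < m + 1 / real (Suc k)" by simp
  then obtain s where s: "\<And>k. s k \<in> carrier H" and Js: "\<And>k. J (s k) < m + 1 / real (Suc k)" by metis
  \<comment> \<open>Parallelogram identity for the form, evaluated at the midpoint. By coercivity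
    near-minimisers lie close together, so the minimising sequence is Cauchy.\<close>
  have midpoint: "c / 2 * (cnorm H (x \<ominus> y))\<^sup>2 \<le> J x + J y - 2 * m"
    if x: "x \<in> carrier H" and y: "y \<in> carrier H" for x y
  proof -
    let ?v = "(1/2) \<odot> (x \<oplus> y)"
    have "J x + J y - 2 * J ?v = q (x \<ominus> y) / 2"
      unfolding J_def q_def using x y by (simp add: f_add f_smult field_simps)
    moreover have "c * (cnorm H (x \<ominus> y))\<^sup>2 \<le> q (x \<ominus> y)" unfolding q_def using x y by (intro coercive) auto
    moreover have "m \<le> J ?v" using x y by (intro m_le) auto
    ultimately show ?thesis by (simp add: field_simps)
  qed
  have "\<exists>N. \<forall>k\<ge>N. \<forall>l\<ge>N. cnorm H (s k \<ominus> s l) < e" if e: "0 < e" for e :: real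
  proof -
    \<comment> \<open>Two excesses 1 / (k + 1) and 1 / (l + 1), each below c e^2 / 4, bound the
      right side of \<open>midpoint\<close> by c / 2 times e^2.\<close>
    obtain N where N: "4 / (c * e\<^sup>2) < real N" using reals_Archimedean2 by blast
    have "cnorm H (s k \<ominus> s l) < e" if k: "N \<le> k" and l: "N \<le> l" for k l
    proof -
      have ce: "0 < c * e\<^sup>2" using \<open>0 < c\<close> e by simp
      have *: "1 / real (Suc k) < c * e\<^sup>2 / 4" if "N \<le> k" for k
      proof -
        have "4 / (c * e\<^sup>2) < real (Suc k)" using N that by simp
        then show ?thesis using ce by (simp add: divide_simps mult.commute)
      qed
      have "c / 2 * (cnorm H (s k \<ominus> s l))\<^sup>2 < c / 2 * e\<^sup>2"
        using midpoint[OF s s, of k l] Js[of k] Js[of l] *[OF k] *[OF l] by argo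
      then have "(cnorm H (s k \<ominus> s l))\<^sup>2 < e\<^sup>2" using \<open>0 < c\<close> by simp
      then show ?thesis using e by (simp add: power2_less_imp_less)
    qed
    then show ?thesis by blast
  qed
  from complete[OF s this] obtain x
    where x: "x \<in> carrier H" and lim: "(\<lambda>k. cnorm H (s k \<ominus> x)) \<longlonglongrightarrow> 0" by blast
  \<comment> \<open>The inequality J (s k + v) >= m > J (s k) - 1 / (k + 1) is expanded before the
    limit is taken, so only the term linear in v has to converge.\<close>
  have variation: "2 * Re (f v - cinner H v (S x)) \<le> q v" if v: "v \<in> carrier H" for v
  proof -
    have "2 * Re (f v - cinner H v (S (s k))) \<le> q v + 1 / real (Suc k)" for k
    proof -
      have "J (s k \<oplus> v) = J (s k) + q v - 2 * Re (f v - cinner H v (S (s k)))"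
        unfolding J_def q_def using s v selfadjoint[OF v s, of k] cinner_commute[of "S (s k)" v]
        by (simp add: f_add f_smult)
      moreover have "m \<le> J (s k \<oplus> v)" using s v by (intro m_le) auto
      ultimately show ?thesis using Js[of k] by linarith
    qed
    moreover have "(\<lambda>k. cinner H v (S (s k))) \<longlonglongrightarrow> cinner H v (S x)"
    proof (rule LIM_zero_cancel, rule tendsto_0_le[OF lim])
      show "\<forall>\<^sub>F k in sequentially. cmod (cinner H v (S (s k)) - cinner H v (S x))
          \<le> norm (cnorm H (s k \<ominus> x)) * cnorm H (S v)"
      proof (intro always_eventually allI)
        fix k
        show "cmod (cinner H v (S (s k)) - cinner H v (S x)) \<le> norm (cnorm H (s k \<ominus> x)) * cnorm H (S v)"
          using Cauchy_Schwarz[of "S v" "s k \<ominus> x"] s v x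
          by (simp add: selfadjoint[symmetric] mult.commute)
      qed
    qed
    then have "(\<lambda>k. 2 * Re (f v - cinner H v (S (s k)))) \<longlonglongrightarrow> 2 * Re (f v - cinner H v (S x))"
      by (intro tendsto_intros)
    moreover have "(\<lambda>k. q v + 1 / real (Suc k)) \<longlonglongrightarrow> q v + 0"
      using LIMSEQ_inverse_real_of_nat unfolding inverse_eq_divide
      by (rule tendsto_add[OF tendsto_const])
    ultimately have "2 * Re (f v - cinner H v (S x)) \<le> q v + 0" by (intro LIMSEQ_le) auto
    then show ?thesis by simp
  qed
  show ?thesis
  proof (intro bexI[OF _ x] ballI)
    fix z assume z: "z \<in> carrier H"
    define g where "g = f z - cinner H z (S x)"
    \<comment> \<open>At v = r conj(g) z, \<open>variation\<close> reads 2 r |g|^2 <= r^2 |g|^2 q z.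
      This r makes the product of r and q z less than 1, so g must vanish.\<close>
    define r where "r = 1 / (q z + 1)"
    have qz: "0 \<le> q z" unfolding q_def using z by (rule form_nonneg)
    then have r: "0 < r" unfolding r_def by simp
    let ?v = "(of_real r * cnj g) \<odot> z"
    have 1: "f ?v - cinner H ?v (S x) = of_real r * (g * cnj g)"
      using z x by (simp add: f_smult g_def algebra_simps)
    have "cinner H (S ?v) ?v = of_real (r\<^sup>2) * (g * cnj g) * cinner H (S z) z"
      using z by (simp add: power2_eq_square)
    then have 2: "q ?v = r\<^sup>2 * (cmod g)\<^sup>2 * q z"
      unfolding complex_norm_square[symmetric] q_def
      by (metis Re_complex_of_real form_eq of_real_mult z)
    have "2 * (r * (cmod g)\<^sup>2) \<le> r\<^sup>2 * (cmod g)\<^sup>2 * q z"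
      using variation[of ?v] z unfolding 1 2 complex_norm_square[symmetric] by simp
    then have "r * (cmod g)\<^sup>2 * (2 - r * q z) \<le> 0"
      by (simp add: algebra_simps power2_eq_square)
    moreover have "r * q z < 1" unfolding r_def using qz by simp
    ultimately have "(cmod g)\<^sup>2 \<le> 0" using r by (simp add: mult_le_0_iff)
    then show "f z = cinner H z (S x)" by (simp add: g_def)
  qed
qed

lemma coercive_surj:
  assumes "0 < c" and "\<And>x. x \<in> carrier H \<Longrightarrow> c * (cnorm H x)\<^sup>2 \<le> Re (cinner H (S x) x)"
    and u: "u \<in> carrier H"
  obtains x where "x \<in> carrier H" "S x = u"
proof -
  have "\<exists>x\<in>carrier H. \<forall>z\<in>carrier H. cinner H z u = cinner H z (S x)"
    by (rule Lax_Milgram[OF assms(1,2), of "\<lambda>z. cinner H z u" "cnorm H u"])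
      (use u Cauchy_Schwarz[of _ u] in \<open>auto simp: mult.commute\<close>)
  then show ?thesis using that u by (metis cinner_ext closed)
qed

end

lemma (in complex_hilbert_space) Riesz:
  assumes "\<And>x y. x \<in> carrier H \<Longrightarrow> y \<in> carrier H \<Longrightarrow> f (x \<oplus> y) = f x + f y"
    and "\<And>x a. x \<in> carrier H \<Longrightarrow> f (a \<odot> x) = a * f x"
    and "\<And>x. x \<in> carrier H \<Longrightarrow> cmod (f x) \<le> M * cnorm H x"
  shows "\<exists>x\<in>carrier H. \<forall>z\<in>carrier H. f z = cinner H z x"
proof -
  have "positive_operator H (\<lambda>x. x)" by unfold_locales (rule positive_ident)
  from positive_operator.Lax_Milgram[OF this, of 1 f M] show ?thesis
    using assms by (simp add: Re_cinner_self)
qed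

section \<open>Adjoints, and closure properties of bounded operators\<close>

context hilbert_operator
begin

abbreviation "T' \<equiv> adjoint_op H K T"

lemma
  assumes y: "y \<in> carrier K"
  shows adjoint_closed [simp]: "T' y \<in> carrier H"
    and adjoint: "z \<in> carrier H \<Longrightarrow> cinner K (T z) y = cinner H z (T' y)"
proof -
  obtain c where c: "0 < c" "\<And>x. x \<in> carrier H \<Longrightarrow> cnorm K (T x) \<le> c * cnorm H x" by (rule bound) blast
  have le: "cmod (cinner K (T x) y) \<le> c * cnorm K y * cnorm H x" if "x \<in> carrier H" for x
    using K.Cauchy_Schwarz[OF closed[OF that] y] mult_right_mono[OF c(2)[OF that], of "cnorm K y"] y
    by (simp add: mult.commute mult.left_commute)
  have "\<exists>x\<in>carrier H. \<forall>z\<in>carrier H. cinner K (T z) y = cinner H z x"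
    by (rule H.Riesz[OF _ _ le]) (use y in auto)
  then obtain x where x: "x \<in> carrier H"
    and eq: "\<And>z. z \<in> carrier H \<Longrightarrow> cinner K (T z) y = cinner H z x" by blast
  have "T' y = x"
    unfolding adjoint_op_def
  proof (rule the_equality)
    show "w = x" if w: "w \<in> carrier H \<and> (\<forall>z\<in>carrier H. cinner K (T z) y = cinner H z w)" for w
      by (rule H.cinner_ext) (use w x in \<open>simp_all add: eq[symmetric]\<close>)
  qed (simp add: x eq)
  then show "T' y \<in> carrier H" "z \<in> carrier H \<Longrightarrow> cinner K (T z) y = cinner H z (T' y)"
    using x eq by simp_all
qed

lemma adjoint_left:
  assumes "y \<in> carrier K" "z \<in> carrier H"
  shows "cinner H (T' y) z = cinner K y (T z)"
  by (metis adjoint adjoint_closed closed H.cinner_commute K.cinner_commute assms)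

lemma adjoint_bounded: "T' \<in> bounded_ops K H"
proof -
  obtain c where c: "0 < c" "\<And>x. x \<in> carrier H \<Longrightarrow> cnorm K (T x) \<le> c * cnorm H x" by (rule bound) blast
  have le: "cnorm H (T' y) \<le> c * cnorm K y" if y: "y \<in> carrier K" for y
  proof -
    let ?n = "cnorm H (T' y)"
    have "?n * ?n = cmod (cinner K (T (T' y)) y)"
      using y by (simp add: adjoint H.cinner_self power2_eq_square norm_mult)
    also have "\<dots> \<le> cnorm K (T (T' y)) * cnorm K y" using y by (intro K.Cauchy_Schwarz) auto
    also have "\<dots> \<le> c * ?n * cnorm K y" using y by (intro mult_right_mono c) auto
    finally have "?n * ?n \<le> ?n * (c * cnorm K y)" by (simp add: mult_ac)
    moreover have "0 \<le> ?n" "0 \<le> c * cnorm K y" using y c by auto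
    ultimately show ?thesis by (metis mult_le_cancel_left_pos order_le_less)
  qed
  show ?thesis
    by (rule bounded_opsI[where c = c])
      (auto intro!: H.cinner_ext le simp: adjoint[symmetric])
qed

lemma hilbert_operator_adjoint: "hilbert_operator K H T'"
  by (intro hilbert_operator.intro hilbert_operator_axioms.intro adjoint_bounded) unfold_locales

end

lemma bounded_ops_comp:
  assumes "complex_hilbert_space H" "complex_hilbert_space K" "complex_hilbert_space L"
    and S: "S \<in> bounded_ops H K" and T: "T \<in> bounded_ops K L"
  shows "(\<lambda>x. T (S x)) \<in> bounded_ops H L"
proof -
  interpret S: hilbert_operator H K S using assms by (simp add: hilbert_operator_def hilbert_operator_axioms_def)
  interpret T: hilbert_operator K L T using assms by (simp add: hilbert_operator_def hilbert_operator_axioms_def)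
  obtain c where c: "0 < c" "\<And>x. x \<in> carrier H \<Longrightarrow> cnorm K (S x) \<le> c * cnorm H x" by (rule S.bound) blast
  obtain d where d: "0 < d" "\<And>x. x \<in> carrier K \<Longrightarrow> cnorm L (T x) \<le> d * cnorm K x" by (rule T.bound) blast
  show ?thesis
  proof (rule bounded_opsI[where c = "d * c"])
    fix x assume x: "x \<in> carrier H"
    have "cnorm L (T (S x)) \<le> d * cnorm K (S x)" using x d by simp
    also have "\<dots> \<le> d * (c * cnorm H x)" using x c d by (intro mult_left_mono) auto
    finally show "cnorm L (T (S x)) \<le> d * c * cnorm H x" by (simp add: mult.assoc)
  qed auto
qed

lemma (in complex_hilbert_space) bounded_ops_add:
  assumes "complex_hilbert_space K" and S: "S \<in> bounded_ops K H" and T: "T \<in> bounded_ops K H"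
  shows "(\<lambda>x. S x \<oplus> T x) \<in> bounded_ops K H"
proof -
  interpret S: hilbert_operator K H S using assms complex_hilbert_space_axioms by (simp add: hilbert_operator_def hilbert_operator_axioms_def)
  interpret T: hilbert_operator K H T using assms complex_hilbert_space_axioms by (simp add: hilbert_operator_def hilbert_operator_axioms_def)
  obtain c where c: "0 < c" "\<And>x. x \<in> carrier K \<Longrightarrow> cnorm H (S x) \<le> c * cnorm K x" by (rule S.bound) blast
  obtain d where d: "0 < d" "\<And>x. x \<in> carrier K \<Longrightarrow> cnorm H (T x) \<le> d * cnorm K x" by (rule T.bound) blast
  show ?thesis
  proof (rule bounded_opsI[where c = "c + d"])
    fix x assume x: "x \<in> carrier K"
    show "cnorm H (S x \<oplus> T x) \<le> (c + d) * cnorm K x"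
      using cnorm_triangle[of "S x" "T x"] c(2)[OF x] d(2)[OF x] x by (simp add: distrib_right)
  qed (auto intro!: cinner_ext simp: algebra_simps)
qed

lemma (in complex_hilbert_space) bounded_ops_smult:
  assumes "complex_hilbert_space K" and S: "S \<in> bounded_ops K H"
  shows "(\<lambda>x. a \<odot> S x) \<in> bounded_ops K H"
proof -
  interpret S: hilbert_operator K H S using assms complex_hilbert_space_axioms by (simp add: hilbert_operator_def hilbert_operator_axioms_def)
  obtain c where c: "0 < c" "\<And>x. x \<in> carrier K \<Longrightarrow> cnorm H (S x) \<le> c * cnorm K x" by (rule S.bound) blast
  show ?thesis
  proof (rule bounded_opsI[where c = "cmod a * c"])
    fix x assume x: "x \<in> carrier K"
    show "cnorm H (a \<odot> S x) \<le> (cmod a * c) * cnorm K x"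
      using c(2)[OF x] x by (simp add: mult_left_mono mult.assoc)
  qed (auto intro!: cinner_ext simp: algebra_simps)
qed

locale hilbert_endomorphism = hilbert_operator H H T for H T
begin

text \<open>The lower bound for the adjoint makes T T' coercive, so T T', and with it T, is onto.
  The lower bound for T gives injectivity and the bound 1 / c for the inverse.\<close>

lemma invertible:
  assumes c: "0 < c" and T_below: "\<And>x. x \<in> carrier H \<Longrightarrow> c * cnorm H x \<le> cnorm H (T x)"
    and T'_below: "\<And>x. x \<in> carrier H \<Longrightarrow> c * cnorm H x \<le> cnorm H (T' x)"
  obtains G where "G \<in> bounded_ops H H" "\<And>x. x \<in> carrier H \<Longrightarrow> G (T x) = x"
    "\<And>x. x \<in> carrier H \<Longrightarrow> T (G x) = x"
proof -
  interpret adj: hilbert_operator H H T' by (rule hilbert_operator_adjoint)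
  have form: "cinner H (T (T' x)) x = of_real ((cnorm H (T' x))\<^sup>2)" if "x \<in> carrier H" for x
    using that by (simp add: adjoint H.cinner_self)
  have "positive_op H (\<lambda>x. T (T' x))"
    unfolding positive_op_def
    using bounded_ops_comp[OF _ _ _ adjoint_bounded bounded] H.complex_hilbert_space_axioms
    by (auto simp: form simp del: of_real_power)
  then interpret TT: positive_operator H "\<lambda>x. T (T' x)" by unfold_locales
  have coercive: "c\<^sup>2 * (cnorm H x)\<^sup>2 \<le> Re (cinner H (T (T' x)) x)" if x: "x \<in> carrier H" for x
  proof -
    have "(c * cnorm H x)\<^sup>2 \<le> (cnorm H (T' x))\<^sup>2" using x c by (intro power_mono T'_below) auto
    then show ?thesis using x by (simp add: form power_mult_distrib del: of_real_power)
  qed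
  have inj: "x = y" if "x \<in> carrier H" "y \<in> carrier H" "T x = T y" for x y
  proof -
    have "T (x \<ominus>\<^bsub>H\<^esub> y) = \<zero>\<^bsub>H\<^esub>" using that by simp
    then have "c * cnorm H (x \<ominus>\<^bsub>H\<^esub> y) \<le> 0" using T_below[of "x \<ominus>\<^bsub>H\<^esub> y"] that by simp
    then have "cnorm H (x \<ominus>\<^bsub>H\<^esub> y) \<le> 0" using c by (simp add: mult_le_0_iff)
    moreover have "0 \<le> cnorm H (x \<ominus>\<^bsub>H\<^esub> y)" using that by simp
    ultimately have "cnorm H (x \<ominus>\<^bsub>H\<^esub> y) = 0" by simp
    then show ?thesis using that by simp
  qed
  have "\<exists>x\<in>carrier H. T x = u" if "u \<in> carrier H" for u
    using TT.coercive_surj[OF _ coercive that] c by (metis adjoint_closed zero_less_power)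
  then obtain G where G: "\<And>u. u \<in> carrier H \<Longrightarrow> G u \<in> carrier H" "\<And>u. u \<in> carrier H \<Longrightarrow> T (G u) = u"
    by metis
  have "G \<in> bounded_ops H H"
  proof (rule bounded_opsI[where c = "1 / c"])
    fix x assume x: "x \<in> carrier H"
    have "c * cnorm H (G x) \<le> cnorm H x" using T_below[of "G x"] G[OF x] by simp
    then show "cnorm H (G x) \<le> 1 / c * cnorm H x" using c by (simp add: field_simps)
  next
    show "G (x \<oplus>\<^bsub>H\<^esub> y) = G x \<oplus>\<^bsub>H\<^esub> G y" if "x \<in> carrier H" "y \<in> carrier H" for x y
      by (rule inj) (simp_all add: that G)
    show "G (a \<odot>\<^bsub>H\<^esub> x) = a \<odot>\<^bsub>H\<^esub> G x" if "x \<in> carrier H" for x a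
      by (rule inj) (simp_all add: that G)
  qed (rule G)
  moreover have "G (T x) = x" if "x \<in> carrier H" for x by (rule inj) (simp_all add: that G)
  ultimately show ?thesis using that G(2) by blast
qed

end

section \<open>Square roots\<close>

lemma (in complex_hilbert_space) cinner_tendsto_left:
  assumes s: "\<And>k. s k \<in> carrier H" and x: "x \<in> carrier H" and z: "z \<in> carrier H"
    and lim: "(\<lambda>k :: nat. cnorm H (s k \<ominus> x)) \<longlonglongrightarrow> 0"
  shows "(\<lambda>k. cinner H (s k) z) \<longlonglongrightarrow> cinner H x z"
proof (rule LIM_zero_cancel, rule tendsto_0_le[OF lim], intro always_eventually allI)
  fix k
  show "cmod (cinner H (s k) z - cinner H x z) \<le> norm (cnorm H (s k \<ominus> x)) * cnorm H z"
    using Cauchy_Schwarz[of "s k \<ominus> x" z] s x z by simp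
qed

context positive_operator
begin

text \<open>This is S^2 <= r S: apply the Cauchy-Schwarz inequality of the form to x and S x, bound
  the second factor by r ||S x||^2, and cancel ||S x||^2.\<close>

lemma cnorm_sq_le_form:
  assumes r: "\<And>x. x \<in> carrier H \<Longrightarrow> cnorm H (S x) \<le> r * cnorm H x" and x: "x \<in> carrier H"
  shows "(cnorm H (S x))\<^sup>2 \<le> r * Re (cinner H (S x) x)"
proof -
  let ?n = "cnorm H (S x)"
  have n: "0 \<le> ?n" using x by simp
  have "(?n\<^sup>2)\<^sup>2 = (cmod (cinner H (S x) (S x)))\<^sup>2"
    using x by (simp add: cinner_self norm_power)
  also have "\<dots> \<le> Re (cinner H (S x) x) * Re (cinner H (S (S x)) (S x))"
    using x by (intro form_Cauchy_Schwarz) auto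
  also have "\<dots> \<le> Re (cinner H (S x) x) * (r * ?n\<^sup>2)"
  proof (intro mult_left_mono form_nonneg x)
    have "Re (cinner H (S (S x)) (S x)) \<le> cnorm H (S (S x)) * ?n"
      using x by (intro order_trans[OF complex_Re_le_cmod] Cauchy_Schwarz) auto
    also have "\<dots> \<le> r * ?n * ?n" using x n by (intro mult_right_mono r) auto
    finally show "Re (cinner H (S (S x)) (S x)) \<le> r * ?n\<^sup>2" by (simp add: power2_eq_square)
  qed
  finally have "?n\<^sup>2 * ?n\<^sup>2 \<le> ?n\<^sup>2 * (r * Re (cinner H (S x) x))"
    by (simp add: power2_eq_square mult_ac)
  moreover have "0 \<le> r * Re (cinner H (S x) x)" if "0 < ?n"
  proof -
    have "0 < r * cnorm H x" using r[OF x] that by linarith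
    then have "0 \<le> r" using x cnorm_nonneg[OF x] by (auto simp: zero_less_mult_iff)
    then show ?thesis using form_nonneg[OF x] by simp
  qed
  moreover have ?thesis if "?n = 0" using that x by simp
  ultimately show ?thesis using n
    by (metis mult_le_cancel_left_pos order_le_less zero_less_power)
qed

lemma form_zero:
  assumes x: "x \<in> carrier H" and "Re (cinner H (S x) x) = 0"
  shows "S x = \<zero>"
proof -
  obtain r where "0 < r" and r: "\<And>x. x \<in> carrier H \<Longrightarrow> cnorm H (S x) \<le> r * cnorm H x" by (rule bound) blast
  from cnorm_sq_le_form[OF r x] assms have "cnorm H (S x) = 0" by simp
  then show ?thesis using x by simp
qed

text \<open>In ||x - a S x||^2 = ||x||^2 - 2 a <S x, x> + a^2 ||S x||^2 the choice a = 1 / r lets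
  \<open>cnorm_sq_le_form\<close> absorb the last term into half of the middle one.\<close>

lemma cnorm_diff_contraction:
  assumes r: "\<And>x. x \<in> carrier H \<Longrightarrow> cnorm H (S x) \<le> r * cnorm H x" and "0 < r" and x: "x \<in> carrier H"
  shows "cnorm H (x \<ominus> of_real (1 / r) \<odot> S x) \<le> cnorm H x"
proof (rule power2_le_imp_le)
  let ?q = "Re (cinner H (S x) x)"
  have "(cnorm H (x \<ominus> of_real a \<odot> S x))\<^sup>2 = (cnorm H x)\<^sup>2 - 2 * a * ?q + a\<^sup>2 * (cnorm H (S x))\<^sup>2" for a
    using selfadjoint[OF x x, symmetric] x
    by (simp add: Re_cinner_self[symmetric]) (simp add: power2_eq_square algebra_simps)
  from this[of "1 / r"] have "(cnorm H (x \<ominus> of_real (1 / r) \<odot> S x))\<^sup>2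
      = (cnorm H x)\<^sup>2 - 2 / r * ?q + (1 / r)\<^sup>2 * (cnorm H (S x))\<^sup>2"
    by simp
  also have "(1 / r)\<^sup>2 * (cnorm H (S x))\<^sup>2 \<le> (1 / r)\<^sup>2 * (r * ?q)"
    by (intro mult_left_mono cnorm_sq_le_form r x) auto
  also have "(1 / r)\<^sup>2 * (r * ?q) = 1 / r * ?q" using \<open>0 < r\<close> by (simp add: power2_eq_square)
  also have "(cnorm H x)\<^sup>2 - 2 / r * ?q + 1 / r * ?q \<le> (cnorm H x)\<^sup>2"
    using \<open>0 < r\<close> form_nonneg[OF x] by (simp add: field_simps)
  finally show "(cnorm H (x \<ominus> of_real (1 / r) \<odot> S x))\<^sup>2 \<le> (cnorm H x)\<^sup>2" by simp
qed (use x in auto)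

end

text \<open>The equation y = (1 + y^2) / 2 has 1 as a double root, so the increments do not decay
  geometrically and the contraction principle is out of reach. A bounded monotone majorant still
  makes the operator iterates Cauchy.\<close>

fun sqrt_majorant :: "nat \<Rightarrow> real" where
  "sqrt_majorant 0 = 0"
| "sqrt_majorant (Suc n) = (1 + (sqrt_majorant n)\<^sup>2) / 2"

lemma sqrt_majorant_bounds: "0 \<le> sqrt_majorant n \<and> sqrt_majorant n \<le> 1"
  by (induction n) (auto simp: power_le_one)

lemma sqrt_majorant_incseq: "incseq sqrt_majorant"
proof (rule incseq_SucI)
  fix n
  \<comment> \<open>Half of this square is the increment.\<close>
  have "0 \<le> (1 - sqrt_majorant n)\<^sup>2" by simp
  then show "sqrt_majorant n \<le> sqrt_majorant (Suc n)" by (simp add: power2_diff)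
qed

lemma sqrt_majorant_Cauchy:
  assumes "0 < e"
  shows "\<exists>N. \<forall>k\<ge>N. \<forall>l\<ge>N. \<bar>sqrt_majorant k - sqrt_majorant l\<bar> < e"
proof -
  have "Bseq sqrt_majorant" by (rule BseqI'[of _ 1]) (use sqrt_majorant_bounds in auto)
  then have "Cauchy sqrt_majorant"
    using Bseq_monoseq_convergent sqrt_majorant_incseq incseq_imp_monoseq convergent_Cauchy by blast
  then show ?thesis using assms by (auto simp: Cauchy_def dist_real_def)
qed

fun (in complex_hilbert_space) sqrt_iter :: "('a \<Rightarrow> 'a) \<Rightarrow> nat \<Rightarrow> 'a \<Rightarrow> 'a" where
  "sqrt_iter X 0 x = \<zero>"
| "sqrt_iter X (Suc n) x = (1/2) \<odot> (X x \<oplus> sqrt_iter X n (sqrt_iter X n x))"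

text \<open>
  The iteration \<open>Y \<mapsto> (X + Y\<^sup>2) / 2\<close> converges to \<open>1 - (1 - X)\<^sup>1\<^sup>/\<^sup>2\<close>; its increments are dominated
  by those of the same iteration for the number \<open>X = 1\<close>.
\<close>

locale selfadjoint_contraction = complex_hilbert_space +
  fixes X
  assumes X_bounded: "X \<in> bounded_ops H H"
    and X_selfadjoint: "\<And>x y. x \<in> carrier H \<Longrightarrow> y \<in> carrier H \<Longrightarrow> cinner H (X x) y = cinner H x (X y)"
    and X_contraction: "\<And>x. x \<in> carrier H \<Longrightarrow> cnorm H (X x) \<le> cnorm H x"
begin

lemmas X_simps [simp] = bounded_opsD[OF X_bounded]

abbreviation "Y \<equiv> sqrt_iter X"

lemma Y_closed [simp]: "x \<in> carrier H \<Longrightarrow> Y n x \<in> carrier H"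
  by (induction n arbitrary: x) auto

lemma Y_add [simp]: "x \<in> carrier H \<Longrightarrow> y \<in> carrier H \<Longrightarrow> Y n (x \<oplus> y) = Y n x \<oplus> Y n y"
proof (induction n arbitrary: x y)
  case (Suc n)
  then show ?case by (intro cinner_ext) (simp_all add: field_simps)
qed simp

lemma Y_smult [simp]: "x \<in> carrier H \<Longrightarrow> Y n (a \<odot> x) = a \<odot> Y n x"
proof (induction n arbitrary: x)
  case 0
  then show ?case by (intro cinner_ext) simp_all
next
  case (Suc n)
  then show ?case by (intro cinner_ext) (simp_all add: field_simps)
qed

lemma Y_diff [simp]: "x \<in> carrier H \<Longrightarrow> y \<in> carrier H \<Longrightarrow> Y n (x \<ominus> y) = Y n x \<ominus> Y n y"
  by (simp add: minus_eq uminus_eq_smult)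

lemma Y_selfadjoint:
  "x \<in> carrier H \<Longrightarrow> y \<in> carrier H \<Longrightarrow> cinner H (Y n x) y = cinner H x (Y n y)"
  by (induction n arbitrary: x y) (auto simp: X_selfadjoint)

lemma Y_bound: "x \<in> carrier H \<Longrightarrow> cnorm H (Y n x) \<le> sqrt_majorant n * cnorm H x"
proof (induction n arbitrary: x)
  case (Suc n)
  let ?y = "sqrt_majorant n"
  have "cnorm H (Y n (Y n x)) \<le> ?y * cnorm H (Y n x)" using Suc by simp
  also have "\<dots> \<le> ?y * (?y * cnorm H x)" using Suc sqrt_majorant_bounds[of n] by (intro mult_left_mono) auto
  finally have "cnorm H (X x \<oplus> Y n (Y n x)) \<le> (1 + ?y\<^sup>2) * cnorm H x"
    using cnorm_triangle[of "X x" "Y n (Y n x)"] X_contraction[of x] Suc.prems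
    by (simp add: distrib_right power2_eq_square mult.assoc)
  then show ?case using Suc.prems by (simp add: norm_divide)
qed simp

lemma Y_contraction:
  assumes x: "x \<in> carrier H"
  shows "cnorm H (Y n x) \<le> cnorm H x"
  using Y_bound[OF x, of n] mult_right_mono[of "sqrt_majorant n" 1 "cnorm H x"]
    sqrt_majorant_bounds[of n] x by simp

text \<open>With D = Y_{n+1} - Y_n one has Y_{n+1}^2 - Y_n^2 = Y_{n+1} D + D Y_n, an order of
  factors that is right for noncommuting operators as well. The norms then follow b^2 - a^2 = b (b -
  a) + (b - a) a for the majorant.\<close>

lemma Y_increment:
  "x \<in> carrier H \<Longrightarrow>
    cnorm H (Y (Suc n) x \<ominus> Y n x) \<le> (sqrt_majorant (Suc n) - sqrt_majorant n) * cnorm H x"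
proof (induction n arbitrary: x)
  case 0
  have "Y (Suc 0) x \<ominus> Y 0 x = (1/2) \<odot> X x" using 0 by (intro cinner_ext) simp_all
  then show ?case using 0 X_contraction[of x] by (simp add: norm_divide)
next
  case (Suc n)
  let ?a = "sqrt_majorant n" and ?b = "sqrt_majorant (Suc n)"
  let ?D = "\<lambda>x. Y (Suc n) x \<ominus> Y n x"
  note x = Suc.prems
  have ab: "0 \<le> ?a" "?a \<le> ?b" "0 \<le> ?b"
    using sqrt_majorant_bounds incseq_SucD[OF sqrt_majorant_incseq] by auto
  have "Y (Suc (Suc n)) x \<ominus> Y (Suc n) x
      = (1/2) \<odot> (X x \<oplus> Y (Suc n) (Y (Suc n) x)) \<ominus> (1/2) \<odot> (X x \<oplus> Y n (Y n x))"
    by (subst (1 4) sqrt_iter.simps(2)) simp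
  also have "\<dots> = (1/2) \<odot> (Y (Suc n) (?D x) \<oplus> ?D (Y n x))"
    using x by (intro cinner_ext) (simp_all add: field_simps del: sqrt_iter.simps)
  finally have eq: "Y (Suc (Suc n)) x \<ominus> Y (Suc n) x = (1/2) \<odot> (Y (Suc n) (?D x) \<oplus> ?D (Y n x))" .
  have "cnorm H (Y (Suc n) (?D x)) \<le> ?b * cnorm H (?D x)"
    using x by (intro Y_bound) (auto simp del: sqrt_iter.simps)
  also have "\<dots> \<le> ?b * ((?b - ?a) * cnorm H x)"
    using ab x by (intro mult_left_mono Suc.IH) auto
  finally have 1: "cnorm H (Y (Suc n) (?D x)) \<le> ?b * ((?b - ?a) * cnorm H x)" .
  have "cnorm H (?D (Y n x)) \<le> (?b - ?a) * cnorm H (Y n x)" using x by (intro Suc.IH) auto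
  also have "\<dots> \<le> (?b - ?a) * (?a * cnorm H x)" using ab x by (intro mult_left_mono Y_bound) auto
  finally have "cnorm H (Y (Suc n) (?D x) \<oplus> ?D (Y n x))
      \<le> ?b * ((?b - ?a) * cnorm H x) + (?b - ?a) * (?a * cnorm H x)"
    using 1 cnorm_triangle[of "Y (Suc n) (?D x)" "?D (Y n x)"] x by (simp del: sqrt_iter.simps sqrt_majorant.simps)
  also have "\<dots> = (?b\<^sup>2 - ?a\<^sup>2) * cnorm H x" by (simp add: algebra_simps power2_eq_square del: sqrt_majorant.simps)
  finally have "cnorm H (Y (Suc (Suc n)) x \<ominus> Y (Suc n) x) \<le> 1/2 * ((?b\<^sup>2 - ?a\<^sup>2) * cnorm H x)"
    unfolding eq using x by (simp add: norm_divide del: sqrt_iter.simps sqrt_majorant.simps)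
  also have "1/2 * (?b\<^sup>2 - ?a\<^sup>2) = sqrt_majorant (Suc (Suc n)) - ?b"
    by (simp add: diff_divide_distrib add_divide_distrib)
  then have "1/2 * ((?b\<^sup>2 - ?a\<^sup>2) * cnorm H x) = (sqrt_majorant (Suc (Suc n)) - ?b) * cnorm H x"
    by (metis mult.assoc)
  finally show ?case .
qed

lemma Y_dist_le:
  assumes x: "x \<in> carrier H" and "k \<le> l"
  shows "cnorm H (Y l x \<ominus> Y k x) \<le> (sqrt_majorant l - sqrt_majorant k) * cnorm H x"
  using \<open>k \<le> l\<close>
proof (induction l rule: dec_induct)
  case base
  then show ?case using x by simp
next
  case (step l)
  have "cnorm H (Y (Suc l) x \<ominus> Y k x) \<le> cnorm H (Y (Suc l) x \<ominus> Y l x) + cnorm H (Y l x \<ominus> Y k x)"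
    using x by (intro cnorm_diff_triangle) (auto simp del: sqrt_iter.simps)
  also have "\<dots> \<le> (sqrt_majorant (Suc l) - sqrt_majorant k) * cnorm H x"
    using step.IH Y_increment[OF x, of l] by (simp add: left_diff_distrib del: sqrt_iter.simps sqrt_majorant.simps)
  finally show ?case .
qed

lemma Y_limit:
  assumes x: "x \<in> carrier H"
  shows "\<exists>y\<in>carrier H. (\<lambda>k. cnorm H (Y k x \<ominus> y)) \<longlonglongrightarrow> 0"
proof (rule complete)
  fix e :: real assume "0 < e"
  \<comment> \<open>The added 1 keeps the tolerance meaningful at x = 0.\<close>
  then have "0 < e / (cnorm H x + 1)" using x by (simp add: add_nonneg_pos)
  then obtain N where N: "\<And>k l. N \<le> k \<Longrightarrow> N \<le> l \<Longrightarrow> \<bar>sqrt_majorant k - sqrt_majorant l\<bar> < e / (cnorm H x + 1)"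
    using sqrt_majorant_Cauchy by blast
  have "cnorm H (Y k x \<ominus> Y l x) \<le> \<bar>sqrt_majorant k - sqrt_majorant l\<bar> * cnorm H x" for k l
  proof (cases "k \<le> l")
    case True
    then show ?thesis
      using Y_dist_le[OF x True] cnorm_diff_commute[of "Y k x" "Y l x"] x incseqD[OF sqrt_majorant_incseq True]
      by simp
  next
    case False
    then show ?thesis
      using Y_dist_le[OF x, of l k] incseqD[OF sqrt_majorant_incseq, of l k] by simp
  qed
  moreover have "\<bar>sqrt_majorant k - sqrt_majorant l\<bar> * cnorm H x < e" if "N \<le> k" "N \<le> l" for k l
  proof -
    have "\<bar>sqrt_majorant k - sqrt_majorant l\<bar> * cnorm H x \<le> \<bar>sqrt_majorant k - sqrt_majorant l\<bar> * (cnorm H x + 1)"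
      by (intro mult_left_mono) auto
    also have "\<dots> < e / (cnorm H x + 1) * (cnorm H x + 1)"
      using N[OF that] x by (intro mult_strict_right_mono) (auto intro: add_nonneg_pos)
    also have "\<dots> = e" using x cnorm_nonneg[OF x] by (simp add: field_simps add_nonneg_eq_0_iff)
    finally show ?thesis .
  qed
  ultimately show "\<exists>N. \<forall>k\<ge>N. \<forall>l\<ge>N. cnorm H (Y k x \<ominus> Y l x) < e" by (meson order_le_less_trans)
qed (use x in simp)

text \<open>The pointwise limit L of the iterates satisfies 2 L = X + L^2, hence (1 - L)^2 = 1 - X.
  The root 1 - L is positive because L is a selfadjoint contraction.\<close>

lemma sqrt_exists:
  obtains S where "positive_op H S" "\<And>x. x \<in> carrier H \<Longrightarrow> S (S x) = x \<ominus> X x"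
proof -
  obtain L where L [simp]: "\<And>x. x \<in> carrier H \<Longrightarrow> L x \<in> carrier H"
    and lim: "\<And>x. x \<in> carrier H \<Longrightarrow> (\<lambda>k. cnorm H (Y k x \<ominus> L x)) \<longlonglongrightarrow> 0"
    using Y_limit by metis
  have tend: "(\<lambda>k. cinner H (Y k x) z) \<longlonglongrightarrow> cinner H (L x) z"
    if "x \<in> carrier H" "z \<in> carrier H" for x z
    by (rule cinner_tendsto_left) (use that lim in auto)
  have L_add: "L (x \<oplus> y) = L x \<oplus> L y" if [simp]: "x \<in> carrier H" "y \<in> carrier H" for x y
  proof (rule cinner_ext_left)
    fix z assume z [simp]: "z \<in> carrier H"
    have "(\<lambda>k. cinner H (Y k (x \<oplus> y)) z) \<longlonglongrightarrow> cinner H (L x \<oplus> L y) z"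
      using tendsto_add[OF tend tend, of x z y z] by simp
    then show "cinner H (L (x \<oplus> y)) z = cinner H (L x \<oplus> L y) z"
      using tend[of "x \<oplus> y" z] by (intro LIMSEQ_unique) auto
  qed simp_all
  have L_smult: "L (a \<odot> x) = a \<odot> L x" if [simp]: "x \<in> carrier H" for a x
  proof (rule cinner_ext_left)
    fix z assume z [simp]: "z \<in> carrier H"
    have "(\<lambda>k. cinner H (Y k (a \<odot> x)) z) \<longlonglongrightarrow> cinner H (a \<odot> L x) z"
      using tendsto_mult_left[OF tend, of x z a] by simp
    then show "cinner H (L (a \<odot> x)) z = cinner H (a \<odot> L x) z"
      using tend[of "a \<odot> x" z] by (intro LIMSEQ_unique) auto
  qed simp_all
  have L_contraction: "cnorm H (L x) \<le> cnorm H x" if x [simp]: "x \<in> carrier H" for x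
  proof -
    have "cmod (cinner H (Y k x) (L x)) \<le> cnorm H x * cnorm H (L x)" for k
      by (rule order_trans[OF Cauchy_Schwarz]) (auto intro!: mult_right_mono Y_contraction)
    then have "cmod (cinner H (L x) (L x)) \<le> cnorm H x * cnorm H (L x)"
      using tendsto_norm[OF tend[of x "L x"]] by (intro LIMSEQ_le_const2) auto
    then have "cnorm H (L x) * cnorm H (L x) \<le> cnorm H x * cnorm H (L x)"
      by (simp add: cinner_self norm_power power2_eq_square norm_mult)
    moreover have "0 \<le> cnorm H (L x)" "0 \<le> cnorm H x" by simp_all
    ultimately show ?thesis by (metis mult_le_cancel_right_pos order_le_less)
  qed
  have L_selfadjoint: "cinner H (L x) y = cinner H x (L y)"
    if [simp]: "x \<in> carrier H" "y \<in> carrier H" for x y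
  proof -
    have "(\<lambda>k. cnj (cinner H (Y k y) x)) \<longlonglongrightarrow> cnj (cinner H (L y) x)"
      by (intro tendsto_cnj tend) simp_all
    moreover have "cnj (cinner H (Y k y) x) = cinner H (Y k x) y" for k
      using Y_selfadjoint[of x y k] cinner_commute[of x "Y k y"] by simp
    ultimately have "cinner H (L x) y = cnj (cinner H (L y) x)"
      using tend[of x y] by (simp add: LIMSEQ_unique)
    then show ?thesis using cinner_commute[of x "L y"] by simp
  qed
  have L_eq: "2 * cinner H (L x) z = cinner H (X x) z + cinner H (L (L x)) z"
    if [simp]: "x \<in> carrier H" "z \<in> carrier H" for x z
  proof -
    \<comment> \<open>Both factors vary with k. Passing through \<open>Y k (L x)\<close> separates
      them, since every \<open>Y k\<close> is a contraction.\<close>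
    have "(\<lambda>k. cnorm H (Y k (Y k x) \<ominus> L (L x))) \<longlonglongrightarrow> 0"
    proof (rule tendsto_sandwich[OF always_eventually always_eventually tendsto_const, rule_format])
      show "cnorm H (Y k (Y k x) \<ominus> L (L x)) \<le> cnorm H (Y k x \<ominus> L x) + cnorm H (Y k (L x) \<ominus> L (L x))" for k
        using cnorm_diff_triangle[of "Y k (Y k x)" "Y k (L x)" "L (L x)"] Y_contraction[of "Y k x \<ominus> L x" k]
        by simp
      show "(\<lambda>k. cnorm H (Y k x \<ominus> L x) + cnorm H (Y k (L x) \<ominus> L (L x))) \<longlonglongrightarrow> 0"
        using tendsto_add[OF lim[of x] lim[of "L x"]] by simp
    qed simp
    then have "(\<lambda>k. cinner H (Y k (Y k x)) z) \<longlonglongrightarrow> cinner H (L (L x)) z"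
      by (intro cinner_tendsto_left) simp_all
    then have 1: "(\<lambda>k. cinner H (X x) z + cinner H (Y k (Y k x)) z) \<longlonglongrightarrow> cinner H (X x) z + cinner H (L (L x)) z"
      by (intro tendsto_add tendsto_const)
    have 2: "2 * cinner H (Y (Suc k) x) z = cinner H (X x) z + cinner H (Y k (Y k x)) z" for k
      by simp
    have "(\<lambda>k. 2 * cinner H (Y (Suc k) x) z) \<longlonglongrightarrow> 2 * cinner H (L x) z"
      by (intro tendsto_mult_left LIMSEQ_Suc tend) simp_all
    from LIMSEQ_unique[OF this[unfolded 2] 1] show ?thesis .
  qed
  show ?thesis
  proof (rule that)
    have "(\<lambda>x. x \<ominus> L x) \<in> bounded_ops H H"
    proof (rule bounded_opsI[where c = 2])
      show "cnorm H (x \<ominus> L x) \<le> 2 * cnorm H x" if "x \<in> carrier H" for x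
        using cnorm_triangle_diff[of x "L x"] L_contraction[OF that] that by simp
      show "x \<oplus> y \<ominus> L (x \<oplus> y) = x \<ominus> L x \<oplus> (y \<ominus> L y)" if "x \<in> carrier H" "y \<in> carrier H" for x y
        using that by (intro cinner_ext) (simp_all add: L_add)
      show "a \<odot> x \<ominus> L (a \<odot> x) = a \<odot> (x \<ominus> L x)" if "x \<in> carrier H" for x a
        using that by (intro cinner_ext) (simp_all add: L_smult right_diff_distrib)
    qed simp
    moreover have "cinner H (L x) x = cnj (cinner H (L x) x)" if "x \<in> carrier H" for x
      using L_selfadjoint[OF that that] cinner_commute[of "L x" x] that by simp
    moreover have "Re (cinner H (L x) x) \<le> Re (cinner H x x)" if "x \<in> carrier H" for x
    proof -
      have "Re (cinner H (L x) x) \<le> cnorm H (L x) * cnorm H x"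
        using that by (intro order_trans[OF complex_Re_le_cmod] Cauchy_Schwarz) auto
      also have "\<dots> \<le> cnorm H x * cnorm H x" using that by (intro mult_right_mono L_contraction) auto
      finally show ?thesis using that by (simp add: Re_cinner_self power2_eq_square)
    qed
    ultimately show "positive_op H (\<lambda>x. x \<ominus> L x)"
      by (simp add: positive_op_def complex_is_Real_iff cinner_self) (metis Reals_cnj_iff complex_is_Real_iff)
    show "x \<ominus> L x \<ominus> L (x \<ominus> L x) = x \<ominus> X x" if [simp]: "x \<in> carrier H" for x
    proof (rule cinner_ext_left)
      fix z assume [simp]: "z \<in> carrier H"
      have "L (x \<ominus> L x) = L x \<ominus> L (L x)"
        by (simp add: minus_eq uminus_eq_smult L_add L_smult)
      then show "cinner H (x \<ominus> L x \<ominus> L (x \<ominus> L x)) z = cinner H (x \<ominus> X x) z"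
        using L_eq[of x z] by simp
    qed simp_all
  qed
qed

end

context positive_operator
begin

lemma positive_op_scale:
  assumes "0 \<le> a"
  shows "positive_op H (\<lambda>x. of_real a \<odot> S x)"
  using assms bounded_ops_smult[OF _ bounded] complex_hilbert_space_axioms
  by (auto simp: positive_op_def complex_is_Real_iff form_nonneg form_real)

text \<open>Rescaling: X = 1 - S / r is a selfadjoint contraction, \<open>sqrt_exists\<close> gives
  R with R^2 = 1 - X = S / r, and R times the root of r is the witness behind the choice in
  \<open>sqrt_op\<close>.\<close>

lemma positive_sqrt_op: "positive_op H (sqrt_op H S)"
  and sqrt_op_square: "x \<in> carrier H \<Longrightarrow> sqrt_op H S (sqrt_op H S x) = S x"
proof -
  obtain r where "0 < r" and r: "\<And>x. x \<in> carrier H \<Longrightarrow> cnorm H (S x) \<le> r * cnorm H x" by (rule bound) blast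
  let ?X = "\<lambda>x. x \<ominus> of_real (1 / r) \<odot> S x"
  interpret X: selfadjoint_contraction H ?X
  proof unfold_locales
    show "?X \<in> bounded_ops H H"
      by (rule bounded_opsI[where c = 1])
        (auto intro: cinner_ext simp: algebra_simps cnorm_diff_contraction[OF r \<open>0 < r\<close>, simplified])
  qed (use cnorm_diff_contraction[OF r \<open>0 < r\<close>] in \<open>auto simp: selfadjoint\<close>)
  obtain R where R: "positive_op H R" "\<And>x. x \<in> carrier H \<Longrightarrow> R (R x) = x \<ominus> ?X x" by (rule X.sqrt_exists) blast
  interpret R: positive_operator H R by unfold_locales (rule R)
  let ?Q = "\<lambda>x. of_real (sqrt r) \<odot> R x"
  have "positive_op H ?Q" using \<open>0 < r\<close> by (intro R.positive_op_scale) simp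
  moreover have "?Q (?Q x) = S x" if x: "x \<in> carrier H" for x
  proof (rule cinner_ext)
    fix z assume z: "z \<in> carrier H"
    have "cinner H z (?Q (?Q x)) = of_real (sqrt r * sqrt r) * cinner H z (R (R x))"
      using x z by (simp del: real_sqrt_mult_self)
    also have "complex_of_real (sqrt r * sqrt r) = of_real r" using \<open>0 < r\<close> by (simp only: real_sqrt_mult_self abs_of_pos)
    also have "of_real r * cinner H z (R (R x)) = cinner H z (S x)" using x z \<open>0 < r\<close> by (simp add: R(2))
    finally show "cinner H z (?Q (?Q x)) = cinner H z (S x)" .
  qed (use x in auto)
  ultimately have "\<exists>Q. positive_op H Q \<and> (\<forall>x\<in>carrier H. Q (Q x) = S x)" by blast
  from someI_ex[OF this] show "positive_op H (sqrt_op H S)"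
    "x \<in> carrier H \<Longrightarrow> sqrt_op H S (sqrt_op H S x) = S x"
    unfolding sqrt_op_def by blast+
qed

end

context hilbert_operator
begin

lemma positive_adjoint_comp: "positive_op H (T' \<circ> T)"
  using bounded_ops_comp[OF _ _ _ bounded adjoint_bounded] H.complex_hilbert_space_axioms K.complex_hilbert_space_axioms
  by (auto simp: positive_op_def adjoint_left K.cinner_self comp_def)

lemma positive_abs_op: "positive_op H (abs_op H K T)"
  and abs_op_square: "x \<in> carrier H \<Longrightarrow> abs_op H K T (abs_op H K T x) = T' (T x)"
proof -
  interpret P: positive_operator H "T' \<circ> T" by unfold_locales (rule positive_adjoint_comp)
  show "positive_op H (abs_op H K T)" unfolding abs_op_def by (rule P.positive_sqrt_op)
  show "x \<in> carrier H \<Longrightarrow> abs_op H K T (abs_op H K T x) = T' (T x)"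
    unfolding abs_op_def by (simp add: P.sqrt_op_square)
qed

end

section \<open>The mixed Schwarz inequality\<close>

text \<open>T and A enter symmetrically, so |T*| is simply \<open>abs_op K H A\<close>. As A is only
  asked to satisfy the defining equation of an adjoint, the composites
  \<open>As j \<circ> Bs i\<close> in \<open>gamma\<close> fit directly as adjoints of
  \<open>B i \<circ> A j\<close>.\<close>

locale adjoint_pair = T: hilbert_operator H K T + A: hilbert_operator K H A
  for H :: "('a, 'm) chilbert_scheme" and K :: "('b, 'k) chilbert_scheme" and T A +
  assumes adjoint_eq: "x \<in> carrier H \<Longrightarrow> y \<in> carrier K \<Longrightarrow> cinner K (T x) y = cinner H x (A y)"
begin

lemma adjoint_eq': "x \<in> carrier H \<Longrightarrow> y \<in> carrier K \<Longrightarrow> cinner H (A y) x = cinner K y (T x)"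
  by (metis adjoint_eq A.closed T.closed T.H.cinner_commute T.K.cinner_commute)

lemma adjoint_pair_sym: "adjoint_pair K H A T"
  by unfold_locales (simp add: adjoint_eq')

lemma adjoint_op_eq: "y \<in> carrier K \<Longrightarrow> adjoint_op H K T y = A y"
  by (rule T.H.cinner_ext) (simp_all add: adjoint_eq[symmetric] T.adjoint[symmetric])

lemma abs_op_square: "x \<in> carrier H \<Longrightarrow> abs_op H K T (abs_op H K T x) = A (T x)"
  by (simp add: T.abs_op_square adjoint_op_eq)

text \<open>
  The difference \<open>D = T |T| - |T\<^sup>*| T\<close> satisfies \<open>|T\<^sup>*| D = - D |T|\<close>, that is
  \<open>(1 + t |T\<^sup>*|) D = D (1 - t |T|)\<close>.  On the left one has an expanding operator and on the right, for small
  \<open>t\<close>, a contraction, which forces \<open>|T\<^sup>*| D = 0\<close>.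
\<close>

lemma abs_op_intertwines:
  assumes "x \<in> carrier H"
  shows "T (abs_op H K T x) = abs_op K H A (T x)"
proof -
  define R where "R = abs_op H K T"
  define Q where "Q = abs_op K H A"
  interpret sym: adjoint_pair K H A T by (rule adjoint_pair_sym)
  interpret R: positive_operator H R by unfold_locales (simp add: R_def T.positive_abs_op)
  interpret Q: positive_operator K Q by unfold_locales (simp add: Q_def A.positive_abs_op)
  have RR: "R (R x) = A (T x)" if "x \<in> carrier H" for x using that by (simp add: R_def abs_op_square)
  have QQ: "Q (Q y) = T (A y)" if "y \<in> carrier K" for y using that by (simp add: Q_def sym.abs_op_square)
  define D where "D x = T (R x) \<ominus>\<^bsub>K\<^esub> Q (T x)" for x
  have D [simp]: "D x \<in> carrier K" if "x \<in> carrier H" for x using that by (simp add: D_def)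
  have D_diff: "D (x \<ominus>\<^bsub>H\<^esub> a \<odot>\<^bsub>H\<^esub> y) = D x \<ominus>\<^bsub>K\<^esub> a \<odot>\<^bsub>K\<^esub> D y" if "x \<in> carrier H" "y \<in> carrier H" for x y a
    using that by (intro T.K.cinner_ext) (simp_all add: D_def algebra_simps)
  \<comment> \<open>T R^2 = T A T = Q^2 T, so D R = Q (Q T - T R).\<close>
  have DR: "D (R x) = \<ominus>\<^bsub>K\<^esub> Q (D x)" if "x \<in> carrier H" for x
    using that by (intro T.K.cinner_ext) (simp_all add: D_def RR QQ)
  obtain r where r: "0 < r" "\<And>x. x \<in> carrier H \<Longrightarrow> cnorm H (R x) \<le> r * cnorm H x" by (rule R.bound) blast
  obtain q where q: "0 < q" "\<And>y. y \<in> carrier K \<Longrightarrow> cnorm K (Q y) \<le> q * cnorm K y" by (rule Q.bound) blast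
  obtain b where b: "0 < b" "\<And>x. x \<in> carrier H \<Longrightarrow> cnorm K (T x) \<le> b * cnorm H x" by (rule T.bound) blast
  define d where "d = b * r + q * b"
  have D_bound: "cnorm K (D x) \<le> d * cnorm H x" if x: "x \<in> carrier H" for x
  proof -
    have "cnorm K (D x) \<le> cnorm K (T (R x)) + cnorm K (Q (T x))"
      unfolding D_def using x by (intro T.K.cnorm_triangle_diff) auto
    also have "cnorm K (T (R x)) \<le> b * cnorm H (R x)" using x by (intro b) auto
    also have "b * cnorm H (R x) \<le> b * (r * cnorm H x)" using x b by (intro mult_left_mono r) auto
    also have "cnorm K (Q (T x)) \<le> q * cnorm K (T x)" using x by (intro q) auto
    also have "q * cnorm K (T x) \<le> q * (b * cnorm H x)" using x q by (intro mult_left_mono b) auto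
    finally show ?thesis by (simp add: d_def algebra_simps)
  qed
  let ?form = "\<lambda>y. Re (cinner K (Q y) y)"
  \<comment> \<open>The step for which \<open>cnorm_diff_contraction\<close> makes 1 - t R
    contractive.\<close>
  define t where "t = 1 / r"
  have t: "0 < t" using r by (simp add: t_def)
  \<comment> \<open>Replacing x by x - t R x turns D x into (1 + t Q) D x. This adds at least 2 t <Q
    D x, D x> to the squared norm and does not lower the form, while ||x|| does not grow. As n is
    arbitrary, the form cannot be positive.\<close>
  have growth: "(cnorm K (D x))\<^sup>2 + 2 * real n * t * ?form (D x) \<le> (d * cnorm H x)\<^sup>2"
    if "x \<in> carrier H" for n x
    using that
  proof (induction n arbitrary: x)
    case 0
    then show ?case using D_bound[of x] by (simp add: power_mono)
  next
    case (Suc n)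
    note x = Suc.prems
    let ?x = "x \<ominus>\<^bsub>H\<^esub> of_real t \<odot>\<^bsub>H\<^esub> R x"
    let ?y = "D x"
    have y: "?y \<in> carrier K" using x by simp
    have Dx: "D ?x = ?y \<oplus>\<^bsub>K\<^esub> of_real t \<odot>\<^bsub>K\<^esub> Q ?y"
      using x by (intro T.K.cinner_ext) (simp_all add: D_diff DR)
    have "cinner K ?y (Q ?y) = cinner K (Q ?y) ?y" using Q.selfadjoint[OF y y] by simp
    then have "(cnorm K (D ?x))\<^sup>2 = (cnorm K ?y)\<^sup>2 + 2 * t * ?form ?y + t\<^sup>2 * (cnorm K (Q ?y))\<^sup>2"
      unfolding Dx using y
      by (simp add: T.K.Re_cinner_self[symmetric]) (simp add: power2_eq_square algebra_simps)
    moreover have "0 \<le> t\<^sup>2 * (cnorm K (Q ?y))\<^sup>2" by simp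
    ultimately have 1: "(cnorm K ?y)\<^sup>2 + 2 * t * ?form ?y \<le> (cnorm K (D ?x))\<^sup>2" by linarith
    have "cinner K (Q (Q ?y)) ?y = cinner K (Q ?y) (Q ?y)" using Q.selfadjoint[of "Q ?y" ?y] y by simp
    then have "?form (D ?x) = ?form ?y + 2 * t * (cnorm K (Q ?y))\<^sup>2 + t\<^sup>2 * ?form (Q ?y)"
      unfolding Dx using y
      by (simp add: T.K.Re_cinner_self[symmetric]) (simp add: power2_eq_square algebra_simps)
    moreover have "0 \<le> 2 * t * (cnorm K (Q ?y))\<^sup>2" "0 \<le> t\<^sup>2 * ?form (Q ?y)"
      using t y Q.form_nonneg[of "Q ?y"] by auto
    ultimately have "?form ?y \<le> ?form (D ?x)" by linarith
    then have 2: "2 * real n * t * ?form ?y \<le> 2 * real n * t * ?form (D ?x)"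
      using t by (intro mult_left_mono) auto
    have "0 \<le> d" using b r q by (simp add: d_def)
    moreover have "cnorm H ?x \<le> cnorm H x"
      unfolding t_def by (rule R.cnorm_diff_contraction[OF r(2,1) x])
    ultimately have 3: "(d * cnorm H ?x)\<^sup>2 \<le> (d * cnorm H x)\<^sup>2"
      using x by (intro power_mono mult_left_mono) auto
    have "(cnorm K ?y)\<^sup>2 + 2 * real (Suc n) * t * ?form ?y
        = (cnorm K ?y)\<^sup>2 + 2 * t * ?form ?y + 2 * real n * t * ?form ?y"
      by (simp add: algebra_simps)
    also have "\<dots> \<le> (d * cnorm H ?x)\<^sup>2"
      using 1 2 Suc.IH[of ?x] x by simp
    finally show ?case using 3 by linarith
  qed
  have QD: "Q (D x) = \<zero>\<^bsub>K\<^esub>" if x: "x \<in> carrier H" for x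
  proof (rule Q.form_zero)
    show "?form (D x) = 0"
    proof (rule ccontr)
      assume "?form (D x) \<noteq> 0"
      then have pos: "0 < 2 * t * ?form (D x)" using Q.form_nonneg[of "D x"] x t by simp
      obtain n where n: "(d * cnorm H x)\<^sup>2 < real n * (2 * t * ?form (D x))"
        using reals_Archimedean3[OF pos] by blast
      have "real n * (2 * t * ?form (D x)) = 2 * real n * t * ?form (D x)" by simp
      then show False using growth[OF x, of n] n zero_le_power2[of "cnorm K (D x)"] by linarith
    qed
  qed (use x in simp)
  \<comment> \<open>T A D x = Q Q D x = 0 forces A D x = 0. So D x is orthogonal to the ranges of T
    and of Q; being a difference of two vectors from these ranges, it vanishes.\<close>
  have AD: "A (D x) = \<zero>\<^bsub>H\<^esub>" if x: "x \<in> carrier H" for x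
  proof -
    have "T (A (D x)) = \<zero>\<^bsub>K\<^esub>"
      using x QQ[of "D x"] QD[of x] Q.diff[of "D x" "D x"] by simp
    then have "cinner H (A (D x)) (A (D x)) = 0"
      using x adjoint_eq[of "A (D x)" "D x"] by simp
    then show ?thesis using x T.H.cinner_eq_zero by simp
  qed
  have "cinner K (D x) (T (R x)) = 0"
    using assms AD[OF assms] adjoint_eq'[of "R x" "D x"] by simp
  moreover have "cinner K (D x) (Q (T x)) = 0"
    using assms QD[OF assms] Q.selfadjoint[of "D x" "T x"] by simp
  moreover have "cinner K (D x) (D x) = cinner K (D x) (T (R x)) - cinner K (D x) (Q (T x))"
    using assms by (subst (2) D_def) simp
  ultimately have "cinner K (D x) (D x) = 0" by simp
  then have "D x = \<zero>\<^bsub>K\<^esub>" using assms T.K.cinner_eq_zero by simp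
  have "T (R x) = Q (T x)"
  proof (rule T.K.cinner_ext)
    fix z assume "z \<in> carrier K"
    then show "cinner K z (T (R x)) = cinner K z (Q (T x))"
      using \<open>D x = \<zero>\<^bsub>K\<^esub>\<close> assms T.K.cinner_diff_right[of "T (R x)" "Q (T x)" z] by (simp add: D_def)
  qed (use assms in auto)
  then show ?thesis by (simp add: R_def Q_def)
qed

text \<open>Let R = |T|. For x = R a the bound is the Cauchy-Schwarz inequality of |T*|, because T R
  a = |T*| T a and <|T*| T a, T a> = <R x, x>. Such x need not exhaust the space, so x is written as
  (R + e) a and e tends to 0.\<close>

lemma mixed_Schwarz:
  assumes x: "x \<in> carrier H" and y: "y \<in> carrier K"
  shows "(cmod (cinner K (T x) y))\<^sup>2
    \<le> Re (cinner H (abs_op H K T x) x) * Re (cinner K (abs_op K H A y) y)"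
proof -
  define R where "R = abs_op H K T"
  define Q where "Q = abs_op K H A"
  interpret R: positive_operator H R by unfold_locales (simp add: R_def T.positive_abs_op)
  interpret Q: positive_operator K Q by unfold_locales (simp add: Q_def A.positive_abs_op)
  have RR: "R (R x) = A (T x)" if "x \<in> carrier H" for x using that by (simp add: R_def abs_op_square)
  have TR: "T (R x) = Q (T x)" if "x \<in> carrier H" for x using that by (simp add: R_def Q_def abs_op_intertwines)
  have T_norm: "cnorm K (T a) = cnorm H (R a)" if a: "a \<in> carrier H" for a
  proof -
    have "cinner H (R a) (R a) = cinner K (T a) (T a)"
      using a R.selfadjoint[of a "R a"] adjoint_eq[of a "T a"] by (simp add: RR)
    then show ?thesis by (simp add: cnorm_def)
  qed
  let ?p = "Re (cinner H (R x) x)" and ?q = "Re (cinner K (Q y) y)"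
  have pq: "0 \<le> ?p" "0 \<le> ?q" using R.form_nonneg Q.form_nonneg x y by auto
  have approx: "cmod (cinner K (T x) y) \<le> sqrt ?p * sqrt ?q + sqrt (e * ?p) * cnorm K y" if e: "0 < e" for e
  proof -
    let ?E = "\<lambda>x. R x \<oplus>\<^bsub>H\<^esub> of_real e \<odot>\<^bsub>H\<^esub> x"
    have "?E \<in> bounded_ops H H"
      using T.H.bounded_ops_add[OF _ R.bounded T.H.bounded_ops_smult[OF _ ident_bounded_op]] T.H.complex_hilbert_space_axioms
      by blast
    then have "positive_op H ?E"
      using e by (auto simp: positive_op_def complex_is_Real_iff R.form_real R.form_nonneg T.H.cinner_self)
    then interpret E: positive_operator H ?E by unfold_locales
    have "e * (cnorm H x)\<^sup>2 \<le> Re (cinner H (?E x) x)" if "x \<in> carrier H" for x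
      using that R.form_nonneg[of x] by (simp add: T.H.Re_cinner_self)
    from E.coercive_surj[OF e this x] obtain a where a: "a \<in> carrier H" and xa: "x = ?E a" by metis
    have sa: "cinner H a (R a) = cinner H (R a) a" using R.selfadjoint[of a a] a by simp
    have sa': "cinner H (R (R a)) a = cinner H (R a) (R a)" using R.selfadjoint[of "R a" a] a by simp
    \<comment> \<open>Three nonnegative terms: the first controls the contribution of R a to x, the
      second, through ||T a|| = ||R a||, that of e a.\<close>
    have p: "?p = Re (cinner H (R (R a)) (R a)) + 2 * e * (cnorm H (R a))\<^sup>2 + e\<^sup>2 * Re (cinner H (R a) a)"
      unfolding xa using a sa'
      by (simp add: T.H.Re_cinner_self[symmetric]) (simp add: power2_eq_square algebra_simps)
    have nonneg: "0 \<le> Re (cinner H (R (R a)) (R a))" "0 \<le> e * (cnorm H (R a))\<^sup>2" "0 \<le> e\<^sup>2 * Re (cinner H (R a) a)"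
      using R.form_nonneg[of "R a"] R.form_nonneg[of a] a e by auto
    have "(cmod (cinner K (T (R a)) y))\<^sup>2 \<le> Re (cinner K (Q (T a)) (T a)) * ?q"
      using a y TR[OF a] Q.form_Cauchy_Schwarz[of "T a" y] by simp
    also have "cinner K (Q (T a)) (T a) = cinner H (R (R a)) (R a)"
    proof -
      have "cinner K (Q (T a)) (T a) = cinner K (T (R a)) (T a)" using a by (simp add: TR)
      also have "\<dots> = cinner H (R a) (R (R a))" using a by (simp add: adjoint_eq RR)
      also have "\<dots> = cinner H (R (R a)) (R a)" using a by (simp add: R.selfadjoint)
      finally show ?thesis .
    qed
    also have "Re (cinner H (R (R a)) (R a)) * ?q \<le> ?p * ?q"
      using p nonneg pq by (intro mult_right_mono) linarith+
    finally have 1: "cmod (cinner K (T (R a)) y) \<le> sqrt ?p * sqrt ?q"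
      using real_le_rsqrt real_sqrt_mult by metis
    have "(e * cnorm K (T a))\<^sup>2 = e * (e * (cnorm H (R a))\<^sup>2)"
      using a by (simp add: T_norm power_mult_distrib power2_eq_square mult_ac)
    also have "\<dots> \<le> e * ?p" using p nonneg e by (intro mult_left_mono) linarith+
    finally have 2: "e * cnorm K (T a) \<le> sqrt (e * ?p)" by (rule real_le_rsqrt)
    have "cinner K (T x) y = cinner K (T (R a)) y + of_real e * cinner K (T a) y"
      unfolding xa using a y by simp
    then have "cmod (cinner K (T x) y) \<le> cmod (cinner K (T (R a)) y) + e * cmod (cinner K (T a) y)"
      using e norm_triangle_ineq by (metis abs_of_pos norm_mult norm_of_real)
    also have "\<dots> \<le> sqrt ?p * sqrt ?q + e * (cnorm K (T a) * cnorm K y)"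
      using 1 a y e by (intro add_mono mult_left_mono T.K.Cauchy_Schwarz) auto
    also have "e * (cnorm K (T a) * cnorm K y) \<le> sqrt (e * ?p) * cnorm K y"
      using mult_right_mono[OF 2, of "cnorm K y"] y by (simp add: mult_ac)
    finally show ?thesis by simp
  qed
  have "(\<lambda>n. sqrt ?p * sqrt ?q + sqrt (inverse (real (Suc n)) * ?p) * cnorm K y)
      \<longlonglongrightarrow> sqrt ?p * sqrt ?q + sqrt (0 * ?p) * cnorm K y"
    by (intro tendsto_intros LIMSEQ_inverse_real_of_nat)
  then have "cmod (cinner K (T x) y) \<le> sqrt ?p * sqrt ?q + sqrt (0 * ?p) * cnorm K y"
    by (rule LIMSEQ_le_const) (use approx in auto)
  then have "(cmod (cinner K (T x) y))\<^sup>2 \<le> (sqrt ?p * sqrt ?q)\<^sup>2" by (intro power_mono) auto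
  then show ?thesis using pq by (simp add: power_mult_distrib R_def Q_def)
qed

end

section \<open>Numerical radii\<close>

lemma (in complex_hilbert_space) unit_multiple:
  assumes "x \<in> carrier H" "x \<noteq> \<zero>"
  shows "0 < cnorm H x" and "cnorm H (of_real (1 / cnorm H x) \<odot> x) = 1"
proof -
  show "0 < cnorm H x" using assms cnorm_nonneg[of x] cnorm_eq_zero[of x] by linarith
  then show "cnorm H (of_real (1 / cnorm H x) \<odot> x) = 1" using assms by (simp add: norm_divide)
qed

context hilbert_operator
begin

lemma zero [simp]: "T \<zero>\<^bsub>H\<^esub> = \<zero>\<^bsub>K\<^esub>"
  using diff[of "\<zero>\<^bsub>H\<^esub>" "\<zero>\<^bsub>H\<^esub>"] by simp

lemma op_norm_upper:
  assumes "x \<in> carrier H" "cnorm H x \<le> 1"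
  shows "cnorm K (T x) \<le> op_norm H K T"
proof -
  obtain c where "0 < c" and c: "\<And>x. x \<in> carrier H \<Longrightarrow> cnorm K (T x) \<le> c * cnorm H x" by (rule bound) blast
  have "cnorm K (T x) \<le> c" if "x \<in> carrier H" "cnorm H x \<le> 1" for x
    using c[OF that(1)] mult_left_mono[OF that(2), of c] \<open>0 < c\<close> by linarith
  then have "bdd_above {cnorm K (T x) | x. x \<in> carrier H \<and> cnorm H x \<le> 1}" by (auto intro!: bdd_aboveI)
  then show ?thesis unfolding op_norm_def using assms by (auto intro!: cSup_upper)
qed

lemma op_norm_nonneg: "0 \<le> op_norm H K T"
  using op_norm_upper[of "\<zero>\<^bsub>H\<^esub>"] by simp

lemma op_norm_bound:
  assumes x: "x \<in> carrier H"
  shows "cnorm K (T x) \<le> op_norm H K T * cnorm H x"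
proof (cases "x = \<zero>\<^bsub>H\<^esub>")
  case False
  note u = H.unit_multiple[OF x this]
  have "cnorm K (T (of_real (1 / cnorm H x) \<odot>\<^bsub>H\<^esub> x)) \<le> op_norm H K T"
    using x u by (intro op_norm_upper) auto
  then show ?thesis using x u by (simp add: norm_divide field_simps)
qed simp

end

lemma (in hilbert_endomorphism) numerical_radius_bound:
  assumes x: "x \<in> carrier H"
  shows "cmod (cinner H (T x) x) \<le> numerical_radius H T * (cnorm H x)\<^sup>2"
proof -
  have "cmod (cinner H (T x) x) \<le> op_norm H H T" if "x \<in> carrier H" "cnorm H x = 1" for x
    using H.Cauchy_Schwarz[of "T x" x] op_norm_bound[of x] that by simp
  then have bdd: "bdd_above (insert 0 {cmod (cinner H (T x) x) | x. x \<in> carrier H \<and> cnorm H x = 1})"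
    using op_norm_nonneg by (auto intro!: bdd_aboveI)
  show "cmod (cinner H (T x) x) \<le> numerical_radius H T * (cnorm H x)\<^sup>2"
  proof (cases "x = \<zero>\<^bsub>H\<^esub>")
    case False
    note u = H.unit_multiple[OF x this]
    let ?u = "of_real (1 / cnorm H x) \<odot>\<^bsub>H\<^esub> x"
    have "cmod (cinner H (T ?u) ?u) \<le> numerical_radius H T"
      unfolding numerical_radius_def
      by (intro cSup_upper bdd insertI2 CollectI exI[of _ ?u] conjI refl u) (use x in simp)
    then show ?thesis using x u by (simp add: norm_divide norm_mult field_simps power2_eq_square)
  qed (use x in simp)
qed

lemma (in complex_hilbert_space) Buzano:
  assumes [simp]: "u \<in> carrier H" "v \<in> carrier H" "y \<in> carrier H"
  shows "2 * (cmod (cinner H u y) * cmod (cinner H y v))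
    \<le> (cnorm H y)\<^sup>2 * (cnorm H u * cnorm H v + cmod (cinner H u v))"
proof -
  \<comment> \<open>\<open>w\<close> is the reflection of \<open>u\<close> in the line through \<open>y\<close>, scaled by \<open>\<parallel>y\<parallel>\<^sup>2\<close>\<close>
  define c where "c = cinner H u y"
  define s where "s = (cnorm H y)\<^sup>2"
  define w where "w = (2 * c) \<odot> y \<ominus> of_real s \<odot> u"
  have yu: "cinner H y u = cnj c" unfolding c_def using cinner_commute[of y u] by simp
  have yy: "cinner H y y = of_real s" by (simp add: s_def cinner_self)
  have w [simp]: "w \<in> carrier H" by (simp add: w_def)
  have "cinner H w w = (of_real s)\<^sup>2 * cinner H u u"
    unfolding w_def by (simp add: yu yy c_def[symmetric] algebra_simps power2_eq_square)
  then have "of_real ((cnorm H w)\<^sup>2) = complex_of_real ((s * cnorm H u)\<^sup>2)"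
    by (simp add: cinner_self power_mult_distrib)
  then have "(cnorm H w)\<^sup>2 = (s * cnorm H u)\<^sup>2" using of_real_eq_iff by blast
  then have norm_w: "cnorm H w = s * cnorm H u" by (simp add: power2_eq_iff_nonneg s_def)
  have "cinner H w v = 2 * (c * cinner H y v) - of_real s * cinner H u v" by (simp add: w_def)
  then have "2 * (c * cinner H y v) = cinner H w v + of_real s * cinner H u v" by simp
  then have "cmod (2 * (c * cinner H y v)) \<le> cmod (cinner H w v) + cmod (of_real s * cinner H u v)"
    by (metis norm_triangle_ineq)
  also have "cmod (cinner H w v) \<le> s * cnorm H u * cnorm H v"
    using Cauchy_Schwarz[of w v] by (simp add: norm_w)
  also have "cmod (of_real s * cinner H u v) = s * cmod (cinner H u v)" by (simp add: norm_mult norm_power s_def)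
  finally show ?thesis by (simp add: norm_mult c_def s_def algebra_simps)
qed

text \<open>Follows from ||A y||^2 = <T A y, y>. In \<open>off_diagonal_bound\<close> it trades the
  norm of an adjoint for that of the product occurring in \<open>gamma\<close>.\<close>

lemma (in adjoint_pair) adjoint_norm_bound:
  assumes y: "y \<in> carrier K"
  shows "cnorm H (A y) \<le> op_norm H K T * cnorm K y"
proof -
  let ?n = "cnorm H (A y)"
  have "?n * ?n = cmod (cinner K (T (A y)) y)"
    using y by (simp add: adjoint_eq T.H.cinner_self power2_eq_square norm_mult)
  also have "\<dots> \<le> cnorm K (T (A y)) * cnorm K y" using y by (intro T.K.Cauchy_Schwarz) auto
  also have "\<dots> \<le> op_norm H K T * ?n * cnorm K y" using y by (intro mult_right_mono T.op_norm_bound) auto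
  finally have "?n * ?n \<le> ?n * (op_norm H K T * cnorm K y)" by (simp add: mult_ac)
  moreover have "0 \<le> ?n" "0 \<le> op_norm H K T * cnorm K y" using y T.op_norm_nonneg by auto
  ultimately show ?thesis by (metis mult_le_cancel_left_pos order_le_less)
qed

text \<open>Both forms are real, so they are the real and imaginary part of the form of P + i
  Q.\<close>

lemma (in complex_hilbert_space) abs_sum_form_le:
  assumes P: "positive_op H P" and Q: "positive_op H Q" and x: "x \<in> carrier H"
  shows "sqrt ((Re (cinner H (P x) x))\<^sup>2 + (Re (cinner H (Q x) x))\<^sup>2)
    \<le> numerical_radius H (\<lambda>x. P x \<oplus> \<i> \<odot> Q x) * (cnorm H x)\<^sup>2"
proof -
  interpret P: positive_operator H P by unfold_locales (rule P)
  interpret Q: positive_operator H Q by unfold_locales (rule Q)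
  interpret F: hilbert_endomorphism H "\<lambda>x. P x \<oplus> \<i> \<odot> Q x"
    by unfold_locales (intro bounded_ops_add bounded_ops_smult P.bounded Q.bounded complex_hilbert_space_axioms)
  have "sqrt ((Re (cinner H (P x) x))\<^sup>2 + (Re (cinner H (Q x) x))\<^sup>2) = cmod (cinner H (P x \<oplus> \<i> \<odot> Q x) x)"
    using x by (simp add: cmod_def P.form_real Q.form_real)
  also have "\<dots> \<le> numerical_radius H (\<lambda>x. P x \<oplus> \<i> \<odot> Q x) * (cnorm H x)\<^sup>2"
    by (rule F.numerical_radius_bound[OF x])
  finally show ?thesis .
qed

lemma off_diagonal_bound:
  assumes "adjoint_pair H K T A" and "adjoint_pair K H S B"
    and x: "x \<in> carrier H" and y: "y \<in> carrier K"
  shows "cmod (cinner K (T x) y) + cmod (cinner H (S y) x) \<le>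
    sqrt (numerical_radius H (\<lambda>x. abs_op H K T x \<oplus>\<^bsub>H\<^esub> \<i> \<odot>\<^bsub>H\<^esub> abs_op H K B x)
        * numerical_radius K (\<lambda>x. abs_op K H A x \<oplus>\<^bsub>K\<^esub> \<i> \<odot>\<^bsub>K\<^esub> abs_op K H S x)
      + op_norm H K T * op_norm K H S + numerical_radius H (S \<circ> T)) * (cnorm H x * cnorm K y)"
    (is "?a + ?b \<le> sqrt (?\<omega>1 * ?\<omega>2 + ?N + ?\<omega>3) * ?xy")
proof -
  interpret T: adjoint_pair H K T A by fact
  interpret S: adjoint_pair K H S B by fact
  note H = T.T.H.complex_hilbert_space_axioms and K = T.T.K.complex_hilbert_space_axioms
  interpret ST: hilbert_endomorphism H "S \<circ> T"
    unfolding comp_def by unfold_locales (rule bounded_ops_comp[OF H K H T.T.bounded S.T.bounded])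
  let ?p = "Re (cinner H (abs_op H K T x) x)" and ?s = "Re (cinner H (abs_op H K B x) x)"
  let ?q = "Re (cinner K (abs_op K H A y) y)" and ?r = "Re (cinner K (abs_op K H S y) y)"
  have "?a\<^sup>2 \<le> ?p * ?q" by (rule T.mixed_Schwarz[OF x y])
  moreover have "?b\<^sup>2 \<le> ?s * ?r" using S.mixed_Schwarz[OF y x] by (simp add: mult.commute)
  \<comment> \<open>Cauchy-Schwarz in the plane, with p and s collected on \<open>H\<close>, q and r
    on \<open>K\<close>. This is what pairs the moduli inside the two radii under the root.\<close>
  moreover have "?p * ?q + ?s * ?r \<le> sqrt (?p\<^sup>2 + ?s\<^sup>2) * sqrt (?q\<^sup>2 + ?r\<^sup>2)"
  proof (rule power2_le_imp_le)
    have "0 \<le> (?p * ?r - ?s * ?q)\<^sup>2" by simp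
    then show "(?p * ?q + ?s * ?r)\<^sup>2 \<le> (sqrt (?p\<^sup>2 + ?s\<^sup>2) * sqrt (?q\<^sup>2 + ?r\<^sup>2))\<^sup>2"
      by (simp add: power_mult_distrib power2_diff power2_sum algebra_simps)
  qed simp
  moreover have "sqrt (?p\<^sup>2 + ?s\<^sup>2) * sqrt (?q\<^sup>2 + ?r\<^sup>2) \<le> (?\<omega>1 * (cnorm H x)\<^sup>2) * (?\<omega>2 * (cnorm K y)\<^sup>2)"
    using T.T.H.abs_sum_form_le[OF T.T.positive_abs_op S.A.positive_abs_op x]
      T.T.K.abs_sum_form_le[OF T.A.positive_abs_op S.T.positive_abs_op y]
    by (intro mult_mono) (auto intro: order_trans[rotated])
  ultimately have squares: "?a\<^sup>2 + ?b\<^sup>2 \<le> ?\<omega>1 * ?\<omega>2 * ?xy\<^sup>2"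
    by (simp add: power_mult_distrib mult_ac)
  \<comment> \<open>With both factors paired against y, \<open>Buzano\<close> applies to T x and B
    x, and <T x, B x> = <S T x, x> produces the third radius.\<close>
  have Sy: "cinner H (S y) x = cinner K y (B x)" by (rule S.adjoint_eq[OF y x])
  have "2 * (?a * ?b) \<le> (cnorm K y)\<^sup>2 * (cnorm K (T x) * cnorm K (B x) + cmod (cinner K (T x) (B x)))"
    unfolding Sy using x y by (intro T.T.K.Buzano) auto
  also have "\<dots> \<le> (cnorm K y)\<^sup>2 * (?N * (cnorm H x)\<^sup>2 + ?\<omega>3 * (cnorm H x)\<^sup>2)"
  proof (intro mult_left_mono add_mono)
    have "cnorm K (T x) * cnorm K (B x) \<le> (op_norm H K T * cnorm H x) * (op_norm K H S * cnorm H x)"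
      using x T.T.op_norm_nonneg by (intro mult_mono T.T.op_norm_bound S.adjoint_norm_bound) auto
    then show "cnorm K (T x) * cnorm K (B x) \<le> ?N * (cnorm H x)\<^sup>2" by (simp add: power2_eq_square mult_ac)
    have "cinner K (T x) (B x) = cinner H ((S \<circ> T) x) x" using x S.adjoint_eq[of "T x" x] by simp
    then show "cmod (cinner K (T x) (B x)) \<le> ?\<omega>3 * (cnorm H x)\<^sup>2"
      using ST.numerical_radius_bound[OF x] by simp
  qed simp
  finally have "2 * (?a * ?b) \<le> (?N + ?\<omega>3) * ?xy\<^sup>2" by (simp add: power_mult_distrib algebra_simps)
  with squares have "(?a + ?b)\<^sup>2 \<le> (?\<omega>1 * ?\<omega>2 + ?N + ?\<omega>3) * ?xy\<^sup>2"
    by (simp add: power2_sum algebra_simps)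
  then have "?a + ?b \<le> sqrt ((?\<omega>1 * ?\<omega>2 + ?N + ?\<omega>3) * ?xy\<^sup>2)" by (rule real_le_rsqrt)
  then show ?thesis using x y by (simp add: real_sqrt_mult)
qed

section \<open>The quadratic form of a scalar matrix\<close>

lemma Cn_simps [simp]:
  "carrier (Cn n) = carrier_vec n" "cinner (Cn n) v w = v \<bullet>c w"
  by (simp_all add: Cn_def module.defs module_vec_def)

lemma
  fixes g :: "nat \<Rightarrow> nat \<Rightarrow> real" and v :: "nat \<Rightarrow> real" and n :: nat
  defines "M \<equiv> mat n n (\<lambda>(i, j). complex_of_real (g i j))"
  shows mat_numerical_radius_nonneg: "0 \<le> mat_numerical_radius n M"
    and quadratic_form_le_mat_numerical_radius:
      "(\<Sum>i<n. \<Sum>j<n. g i j * v i * v j) \<le> mat_numerical_radius n M * (\<Sum>i<n. (v i)\<^sup>2)"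
proof -
  have form: "(M *\<^sub>v u) \<bullet>c u = (\<Sum>i<n. \<Sum>j<n. of_real (g i j) * u $ j * cnj (u $ i))"
    if "u \<in> carrier_vec n" for u
    using that
    by (auto simp: M_def scalar_prod_def sum_distrib_right lessThan_atLeast0 intro!: sum.cong)
  have norm: "cnorm (Cn n) u = sqrt (\<Sum>i<n. (cmod (u $ i))\<^sup>2)" if "u \<in> carrier_vec n" for u
  proof -
    have "u \<bullet>c u = of_real (\<Sum>i<n. (cmod (u $ i))\<^sup>2)"
      unfolding of_real_sum complex_norm_square
      using that by (auto simp: scalar_prod_def lessThan_atLeast0 intro!: sum.cong)
    then show ?thesis by (simp add: cnorm_def)
  qed
  \<comment> \<open>A crude bound by the entries, which makes the supremum in the radius an upper
    bound.\<close>
  have "cmod ((M *\<^sub>v u) \<bullet>c u) \<le> (\<Sum>i<n. \<Sum>j<n. \<bar>g i j\<bar>)"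
    if u: "u \<in> carrier_vec n" and "cnorm (Cn n) u = 1" for u
  proof -
    have le1: "cmod (u $ i) \<le> 1" if "i < n" for i
    proof -
      have "(cmod (u $ i))\<^sup>2 \<le> (\<Sum>i<n. (cmod (u $ i))\<^sup>2)" using that by (intro member_le_sum) auto
      also have "\<dots> = 1" using norm[OF u] \<open>cnorm (Cn n) u = 1\<close> by simp
      finally show ?thesis by (simp add: power_le_one_iff abs_square_le_1)
    qed
    have "cmod ((M *\<^sub>v u) \<bullet>c u) \<le> (\<Sum>i<n. \<Sum>j<n. cmod (of_real (g i j) * u $ j * cnj (u $ i)))"
      unfolding form[OF u] by (intro order_trans[OF norm_sum] sum_mono order_refl)
    also have "\<dots> \<le> (\<Sum>i<n. \<Sum>j<n. \<bar>g i j\<bar>)"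
    proof (intro sum_mono)
      fix i j assume "i \<in> {..<n}" "j \<in> {..<n}"
      then have "cmod (u $ j) * cmod (u $ i) \<le> 1" using le1 by (simp add: mult_le_one)
      then show "cmod (of_real (g i j) * u $ j * cnj (u $ i)) \<le> \<bar>g i j\<bar>"
        using mult_left_mono[of "cmod (u $ j) * cmod (u $ i)" 1 "\<bar>g i j\<bar>"] by (simp add: norm_mult mult.assoc)
    qed
    finally show ?thesis .
  qed
  moreover have "0 \<le> (\<Sum>i<n. \<Sum>j<n. \<bar>g i j\<bar>)" by (intro sum_nonneg) auto
  ultimately have bdd: "bdd_above (insert 0 {cmod (cinner (Cn n) (M *\<^sub>v x) x) | x. x \<in> carrier (Cn n) \<and> cnorm (Cn n) x = 1})"
    by (auto intro!: bdd_aboveI)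
  show "0 \<le> mat_numerical_radius n M"
    unfolding mat_numerical_radius_def numerical_radius_def using bdd by (intro cSup_upper) auto
  define N where "N = (\<Sum>i<n. (v i)\<^sup>2)"
  have "0 \<le> N" by (simp add: N_def sum_nonneg)
  show "(\<Sum>i<n. \<Sum>j<n. g i j * v i * v j) \<le> mat_numerical_radius n M * (\<Sum>i<n. (v i)\<^sup>2)"
  proof (cases "N = 0")
    case True
    then have "\<forall>i\<in>{..<n}. v i = 0" unfolding N_def by (subst (asm) sum_nonneg_eq_0_iff) auto
    then show ?thesis by simp
  next
    case False
    with \<open>0 \<le> N\<close> have N: "0 < N" by simp
    \<comment> \<open>The unit vector in the direction of v. The form is real there, hence at most
      its modulus.\<close>
    define u where "u = vec n (\<lambda>i. complex_of_real (v i / sqrt N))"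
    have u: "u \<in> carrier_vec n" by (simp add: u_def)
    have "(\<Sum>i<n. (cmod (u $ i))\<^sup>2) = (\<Sum>i<n. (v i)\<^sup>2 / N)"
      using N by (intro sum.cong) (auto simp: u_def norm_divide power_divide)
    also have "\<dots> = 1" using N by (simp add: sum_divide_distrib[symmetric] N_def[symmetric])
    finally have norm_u: "cnorm (Cn n) u = 1" by (simp add: norm[OF u])
    have "(M *\<^sub>v u) \<bullet>c u = of_real ((\<Sum>i<n. \<Sum>j<n. g i j * v i * v j) / N)"
      unfolding form[OF u] of_real_sum sum_divide_distrib
      using N by (intro sum.cong refl) (simp add: u_def field_simps flip: of_real_mult)
    then have "(\<Sum>i<n. \<Sum>j<n. g i j * v i * v j) / N \<le> cmod (cinner (Cn n) (M *\<^sub>v u) u)"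
      by (simp only: Cn_simps norm_of_real abs_ge_self)
    also have "\<dots> \<le> mat_numerical_radius n M"
      unfolding mat_numerical_radius_def numerical_radius_def
      by (intro cSup_upper bdd insertI2 CollectI exI[of _ u] conjI refl norm_u) (use u in simp)
    finally show ?thesis using N by (simp add: N_def[symmetric] field_simps)
  qed
qed

text \<open>The entries (i, j) and (j, i) of f are charged together to the entry of g above the
  diagonal; the induction adds the last row and column.\<close>

lemma sum_square_split:
  fixes f g :: "nat \<Rightarrow> nat \<Rightarrow> real"
  assumes "\<And>i. i < n \<Longrightarrow> f i i \<le> g i i"
    and "\<And>i j. i < j \<Longrightarrow> j < n \<Longrightarrow> f i j + f j i \<le> g i j"
    and "\<And>i j. j < i \<Longrightarrow> i < n \<Longrightarrow> g i j = 0"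
  shows "(\<Sum>i<n. \<Sum>j<n. f i j) \<le> (\<Sum>i<n. \<Sum>j<n. g i j)"
  using assms
proof (induction n)
  case (Suc n)
  have split: "(\<Sum>i<Suc n. \<Sum>j<Suc n. h i j) = (\<Sum>i<n. \<Sum>j<n. h i j) + (\<Sum>i<n. h i n + h n i) + h n n"
    for h :: "nat \<Rightarrow> nat \<Rightarrow> real"
    by (simp add: sum.distrib)
  have "(\<Sum>i<n. f i n + f n i) \<le> (\<Sum>i<n. g i n + g n i)"
    using Suc.prems by (intro sum_mono) simp
  moreover have "(\<Sum>i<n. \<Sum>j<n. f i j) \<le> (\<Sum>i<n. \<Sum>j<n. g i j)"
    using Suc.prems by (intro Suc.IH) simp_all
  ultimately show ?case unfolding split using Suc.prems(1)[of n] by simp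
qed simp

section \<open>Sums of operators\<close>

context complex_hilbert_space
begin

lemma cinner_finsum_left:
  assumes "finite I" and y: "y \<in> carrier H" and "\<And>i. i \<in> I \<Longrightarrow> f i \<in> carrier H"
  shows "cinner H (\<Oplus>i\<in>I. f i) y = (\<Sum>i\<in>I. cinner H (f i) y)"
  using assms(1,3)
proof (induction I)
  case (insert i I)
  then have "(\<Oplus>i\<in>insert i I. f i) = f i \<oplus> (\<Oplus>i\<in>I. f i)" by (intro finsum_insert) auto
  then show ?case using insert y by (simp add: finsum_closed Pi_def)
qed (use y in simp)

lemma cinner_finsum_right:
  assumes "finite I" and y: "y \<in> carrier H" and f: "\<And>i. i \<in> I \<Longrightarrow> f i \<in> carrier H"
  shows "cinner H y (\<Oplus>i\<in>I. f i) = (\<Sum>i\<in>I. cinner H y (f i))"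
proof -
  have "(\<Oplus>i\<in>I. f i) \<in> carrier H" using f by (intro finsum_closed) auto
  then have "cinner H y (\<Oplus>i\<in>I. f i) = cnj (\<Sum>i\<in>I. cinner H (f i) y)"
    using cinner_commute[of y] y f by (simp add: cinner_finsum_left[OF assms(1) y])
  also have "\<dots> = (\<Sum>i\<in>I. cinner H y (f i))"
    unfolding cnj_sum using y f by (intro sum.cong refl) (simp add: cinner_commute[of y])
  finally show ?thesis .
qed

lemma cnorm_finsum_le:
  assumes "finite I" and "\<And>i. i \<in> I \<Longrightarrow> f i \<in> carrier H"
  shows "cnorm H (\<Oplus>i\<in>I. f i) \<le> (\<Sum>i\<in>I. cnorm H (f i))"
  using assms
proof (induction I)
  case (insert i I)
  then have "(\<Oplus>i\<in>insert i I. f i) = f i \<oplus> (\<Oplus>i\<in>I. f i)" by (intro finsum_insert) auto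
  moreover have "cnorm H (f i \<oplus> (\<Oplus>i\<in>I. f i)) \<le> cnorm H (f i) + cnorm H (\<Oplus>i\<in>I. f i)"
    using insert by (intro cnorm_triangle finsum_closed) auto
  ultimately show ?case using insert by simp
qed simp

text \<open>Equations between operators, such as the recursion of \<open>finsum\<close>, hold on the
  carrier only, so membership has to be transferred along agreement there.\<close>

lemma bounded_ops_cong:
  assumes K: "complex_hilbert_space K" and S: "S \<in> bounded_ops K H"
    and eq: "\<And>x. x \<in> carrier K \<Longrightarrow> T x = S x"
  shows "T \<in> bounded_ops K H"
proof -
  interpret K: complex_hilbert_space K by (rule K)
  interpret S: hilbert_operator K H S by unfold_locales (rule S)
  obtain c where "0 < c" "\<And>x. x \<in> carrier K \<Longrightarrow> cnorm H (S x) \<le> c * cnorm K x" by (rule S.bound) blast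
  then show ?thesis by (intro bounded_opsI[where c = c]) (simp_all add: eq)
qed

lemma bounded_ops_finsum:
  assumes "finite I" and K: "complex_hilbert_space K" and "\<And>i. i \<in> I \<Longrightarrow> T i \<in> bounded_ops K H"
  shows "(\<lambda>x. \<Oplus>i\<in>I. T i x) \<in> bounded_ops K H"
  using assms(1,3)
proof (induction I)
  case empty
  then show ?case by (simp add: zero_bounded_op)
next
  case (insert j I)
  then have "(\<lambda>x. T j x \<oplus> (\<Oplus>i\<in>I. T i x)) \<in> bounded_ops K H"
    by (intro bounded_ops_add K) auto
  moreover have "(\<Oplus>i\<in>insert j I. T i x) = T j x \<oplus> (\<Oplus>i\<in>I. T i x)" if "x \<in> carrier K" for x
    using insert that bounded_opsD(1) by (intro finsum_insert) fastforce+
  ultimately show ?case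
    by (rule bounded_ops_cong[OF K])
qed

end

text \<open>
  If \<open>u = (\<Sum>\<^sub>j A\<^sub>j B\<^sub>j - z) x\<close>, then applying \<open>B\<^sub>i\<close> and pairing with \<open>x\<^sub>i = B\<^sub>i x\<close> bounds
  \<open>\<bar>z\<bar> \<Sum>\<^sub>i \<parallel>x\<^sub>i\<parallel>\<^sup>2\<close> by \<open>w \<Sum>\<^sub>i \<parallel>x\<^sub>i\<parallel>\<^sup>2\<close> plus terms that are small with \<open>u\<close>.
\<close>

lemma sum_op_bounded_below:
  fixes A B :: "nat \<Rightarrow> 'a \<Rightarrow> 'a" and H :: "nat \<Rightarrow> 'a chilbert" and n :: nat
  assumes H0: "complex_hilbert_space H0"
    and H: "\<And>i. i < n \<Longrightarrow> complex_hilbert_space (H i)"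
    and A: "\<And>i. i < n \<Longrightarrow> A i \<in> bounded_ops (H i) H0"
    and B: "\<And>i. i < n \<Longrightarrow> B i \<in> bounded_ops H0 (H i)"
    and form: "\<And>x. (\<And>i. i < n \<Longrightarrow> x i \<in> carrier (H i)) \<Longrightarrow>
      (\<Sum>i<n. \<Sum>j<n. cmod (cinner (H i) (B i (A j (x j))) (x i))) \<le> w * (\<Sum>i<n. (cnorm (H i) (x i))\<^sup>2)"
    and w: "0 \<le> w" "w < cmod z"
  obtains c where "0 < c" "\<And>x. x \<in> carrier H0 \<Longrightarrow>
    c * cnorm H0 x \<le> cnorm H0 ((\<Oplus>\<^bsub>H0\<^esub>i\<in>{..<n}. A i (B i x)) \<ominus>\<^bsub>H0\<^esub> z \<odot>\<^bsub>H0\<^esub> x)"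
proof -
  interpret H0: complex_hilbert_space H0 by (rule H0)
  have opA: "hilbert_operator (H i) H0 (A i)" and opB: "hilbert_operator H0 (H i) (B i)" if "i < n" for i
    using that H0 H A B by (auto simp: hilbert_operator_def hilbert_operator_axioms_def)
  \<comment> \<open>A sum rather than a maximum: it dominates every single norm and also makes sense
    for n = 0.\<close>
  define a where "a = (\<Sum>i<n. op_norm (H i) H0 (A i))"
  define b where "b = (\<Sum>i<n. op_norm H0 (H i) (B i))"
  have a: "0 \<le> a" "\<And>i. i < n \<Longrightarrow> op_norm (H i) H0 (A i) \<le> a"
    using hilbert_operator.op_norm_nonneg[OF opA] unfolding a_def by (auto intro!: sum_nonneg member_le_sum)
  have b: "0 \<le> b" "\<And>i. i < n \<Longrightarrow> op_norm H0 (H i) (B i) \<le> b"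
    using hilbert_operator.op_norm_nonneg[OF opB] unfolding b_def by (auto intro!: sum_nonneg member_le_sum)
  \<comment> \<open>Chosen so that |z| ||x|| <= ||s|| + ||u|| <= d ||u||: the product accounts for
    s, the added 1 for u.\<close>
  define d where "d = a * real n * (b * real n / (cmod z - w)) + 1"
  have "0 \<le> a * real n * (b * real n / (cmod z - w))" using a b w by (intro mult_nonneg_nonneg divide_nonneg_nonneg) auto
  then have d: "0 < d" by (simp add: d_def)
  show ?thesis
  proof (rule that)
    show "0 < cmod z / d" using w d by (intro divide_pos_pos) linarith+
    fix x assume x: "x \<in> carrier H0"
    define s where "s = (\<Oplus>\<^bsub>H0\<^esub>i\<in>{..<n}. A i (B i x))"
    define u where "u = s \<ominus>\<^bsub>H0\<^esub> z \<odot>\<^bsub>H0\<^esub> x"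
    have Bx: "B i x \<in> carrier (H i)" if "i < n" for i using bounded_opsD(1)[OF B] that x by blast
    have ABx: "A i (B i x) \<in> carrier H0" if "i < n" for i using bounded_opsD(1)[OF A] Bx that by blast
    have s [simp]: "s \<in> carrier H0" unfolding s_def using ABx by (intro H0.finsum_closed) auto
    have u [simp]: "u \<in> carrier H0" using x by (simp add: u_def)
    define V where "V = sqrt (\<Sum>i<n. (cnorm (H i) (B i x))\<^sup>2)"
    have V: "0 \<le> V" "V\<^sup>2 = (\<Sum>i<n. (cnorm (H i) (B i x))\<^sup>2)" by (simp_all add: V_def sum_nonneg)
    have le_V: "cnorm (H i) (B i x) \<le> V" if "i < n" for i
      unfolding V_def using that by (intro real_le_rsqrt member_le_sum) auto
    have component: "cmod z * (cnorm (H i) (B i x))\<^sup>2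
        \<le> (\<Sum>j<n. cmod (cinner (H i) (B i (A j (B j x))) (B i x))) + b * cnorm H0 u * V" if i: "i < n" for i
    proof -
      interpret B: hilbert_operator H0 "H i" "B i" by (rule opB[OF i])
      let ?x = "B i x"
      \<comment> \<open>Moving \<open>B i\<close> to the other side lets the sum be expanded in
        \<open>H0\<close> by linearity of the inner product.\<close>
      have "cinner (H i) (B i u) ?x = cinner H0 u (B.T' ?x)" using x by (simp add: B.adjoint)
      also have "\<dots> = cinner H0 s (B.T' ?x) - z * cinner H0 x (B.T' ?x)" using x by (simp add: u_def)
      also have "cinner H0 s (B.T' ?x) = (\<Sum>j<n. cinner H0 (A j (B j x)) (B.T' ?x))"
        unfolding s_def using x ABx by (intro H0.cinner_finsum_left) auto
      also have "\<dots> = (\<Sum>j<n. cinner (H i) (B i (A j (B j x))) ?x)"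
        using x ABx by (intro sum.cong) (auto simp: B.adjoint)
      also have "z * cinner H0 x (B.T' ?x) = z * of_real ((cnorm (H i) ?x)\<^sup>2)"
        using x by (simp add: B.adjoint[symmetric] B.K.cinner_self)
      finally have eq: "z * of_real ((cnorm (H i) ?x)\<^sup>2)
          = (\<Sum>j<n. cinner (H i) (B i (A j (B j x))) ?x) - cinner (H i) (B i u) ?x" by simp
      have "cmod (z * of_real ((cnorm (H i) ?x)\<^sup>2))
          \<le> (\<Sum>j<n. cmod (cinner (H i) (B i (A j (B j x))) ?x)) + cmod (cinner (H i) (B i u) ?x)"
        unfolding eq by (rule order_trans[OF norm_triangle_ineq4 add_right_mono[OF norm_sum]])
      moreover have "cmod (cinner (H i) (B i u) ?x) \<le> b * cnorm H0 u * V"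
      proof -
        have "cmod (cinner (H i) (B i u) ?x) \<le> cnorm (H i) (B i u) * cnorm (H i) ?x"
          using x by (intro B.K.Cauchy_Schwarz) auto
        also have "\<dots> \<le> (op_norm H0 (H i) (B i) * cnorm H0 u) * V"
          using x i B.op_norm_nonneg by (intro mult_mono B.op_norm_bound le_V) auto
        also have "\<dots> \<le> b * cnorm H0 u * V"
          using b(2)[OF i] V(1) by (intro mult_right_mono) auto
        finally show ?thesis .
      qed
      ultimately show ?thesis by (simp add: norm_mult norm_power)
    qed
    have "cmod z * V\<^sup>2 = (\<Sum>i<n. cmod z * (cnorm (H i) (B i x))\<^sup>2)" by (simp add: V(2) sum_distrib_left)
    also have "\<dots> \<le> (\<Sum>i<n. (\<Sum>j<n. cmod (cinner (H i) (B i (A j (B j x))) (B i x))) + b * cnorm H0 u * V)"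
      by (intro sum_mono component) simp
    also have "\<dots> \<le> w * V\<^sup>2 + real n * (b * cnorm H0 u * V)"
      using form[of "\<lambda>i. B i x"] Bx by (simp add: sum.distrib V(2))
    finally have "V * ((cmod z - w) * V) \<le> V * (b * real n * cnorm H0 u)"
      by (simp add: algebra_simps power2_eq_square)
    moreover have "0 \<le> b * real n * cnorm H0 u" using b by simp
    ultimately have "(cmod z - w) * V \<le> b * real n * cnorm H0 u"
      using V(1) by (cases "V = 0") auto
    then have V_le: "V \<le> b * real n / (cmod z - w) * cnorm H0 u" using w by (simp add: field_simps)
    \<comment> \<open>V only controls the components \<open>B i x\<close>, which may all vanish at a
      nonzero x. The vector x itself comes back from z x = s - u, where z is nonzero and V bounds
      s.\<close>
    have "cnorm H0 s \<le> (\<Sum>i<n. cnorm H0 (A i (B i x)))"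
      unfolding s_def using ABx by (intro H0.cnorm_finsum_le) auto
    also have "\<dots> \<le> (\<Sum>i<n. a * V)"
    proof (rule sum_mono)
      fix i assume "i \<in> {..<n}"
      then have i: "i < n" by simp
      have "cnorm H0 (A i (B i x)) \<le> op_norm (H i) H0 (A i) * cnorm (H i) (B i x)"
        using Bx[OF i] by (rule hilbert_operator.op_norm_bound[OF opA[OF i]])
      also have "\<dots> \<le> a * V"
        using a i le_V complex_hilbert_space.cnorm_nonneg[OF H[OF i] Bx[OF i]] by (intro mult_mono) auto
      finally show "cnorm H0 (A i (B i x)) \<le> a * V" .
    qed
    also have "\<dots> = a * real n * V" by simp
    also have "\<dots> \<le> a * real n * (b * real n / (cmod z - w) * cnorm H0 u)"
      using a by (intro mult_left_mono V_le) auto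
    finally have s_le: "cnorm H0 s \<le> a * real n * (b * real n / (cmod z - w) * cnorm H0 u)" .
    have "z \<odot>\<^bsub>H0\<^esub> x = s \<ominus>\<^bsub>H0\<^esub> u" using x by (intro H0.cinner_ext) (simp_all add: u_def)
    then have "cmod z * cnorm H0 x = cnorm H0 (s \<ominus>\<^bsub>H0\<^esub> u)" using x H0.cnorm_smult by metis
    also have "\<dots> \<le> cnorm H0 s + cnorm H0 u" by (simp add: H0.cnorm_triangle_diff)
    also have "\<dots> \<le> d * cnorm H0 u" using s_le by (simp add: d_def algebra_simps)
    finally show "cmod z / d * cnorm H0 x
        \<le> cnorm H0 ((\<Oplus>\<^bsub>H0\<^esub>i\<in>{..<n}. A i (B i x)) \<ominus>\<^bsub>H0\<^esub> z \<odot>\<^bsub>H0\<^esub> x)"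
      using d by (simp add: u_def s_def field_simps)
  qed
qed

section \<open>The resolvent of the sum\<close>

theorem theorem3p3:
  fixes n :: nat
    and H :: "nat \<Rightarrow> 'a chilbert"
    and A B :: "nat \<Rightarrow> 'a \<Rightarrow> 'a"
  assumes "0 < n"
    and "\<And>i. i < n \<Longrightarrow> complex_hilbert_space (H i)"
    and "\<And>i. i < n \<Longrightarrow> A i \<in> bounded_ops (H i) (H 0)"
    and "\<And>i. i < n \<Longrightarrow> B i \<in> bounded_ops (H 0) (H i)"
  shows "op_spectral_radius (H 0) (\<lambda>x. \<Oplus>\<^bsub>H 0\<^esub>i\<in>{..<n}. A i (B i x))
    \<le> mat_numerical_radius n (mat n n (\<lambda>(i, j). complex_of_real (gamma H A B i j)))"
proof -
  note H = assms(2) and A = assms(3) and B = assms(4)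
  let ?w = "mat_numerical_radius n (mat n n (\<lambda>(i, j). complex_of_real (gamma H A B i j)))"
  let ?S = "\<lambda>x. \<Oplus>\<^bsub>H 0\<^esub>i\<in>{..<n}. A i (B i x)"
  define As where "As k = adjoint_op (H k) (H 0) (A k)" for k
  define Bs where "Bs k = adjoint_op (H 0) (H k) (B k)" for k
  have H0: "complex_hilbert_space (H 0)" using H \<open>0 < n\<close> by blast
  interpret H0: complex_hilbert_space "H 0" by (rule H0)
  have opA: "hilbert_operator (H i) (H 0) (A i)" and opB: "hilbert_operator (H 0) (H i) (B i)" if "i < n" for i
    using that H0 H A B by (auto simp: hilbert_operator_def hilbert_operator_axioms_def)
  note As = hilbert_operator.adjoint_bounded[OF opA, folded As_def]
    and Bs = hilbert_operator.adjoint_bounded[OF opB, folded Bs_def]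
  have comp_op: "hilbert_operator (H j) (H i) (P \<circ> Q)"
    if "i < n" "j < n" "P \<in> bounded_ops (H 0) (H i)" "Q \<in> bounded_ops (H j) (H 0)" for i j P Q
    unfolding hilbert_operator_def hilbert_operator_axioms_def comp_def
    using bounded_ops_comp[OF H[OF that(2)] H0 H[OF that(1)] that(4,3)] H[OF that(1)] H[OF that(2)] by blast
  have pair: "adjoint_pair (H j) (H i) (B i \<circ> A j) (As j \<circ> Bs i)" if ij: "i < n" "j < n" for i j
    unfolding adjoint_pair_def adjoint_pair_axioms_def
  proof (intro conjI allI impI)
    fix x y assume x: "x \<in> carrier (H j)" and y: "y \<in> carrier (H i)"
    have "Bs i y \<in> carrier (H 0)" "A j x \<in> carrier (H 0)"
      using x y bounded_opsD(1)[OF Bs] bounded_opsD(1)[OF A] ij by auto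
    then show "cinner (H i) ((B i \<circ> A j) x) y = cinner (H j) x ((As j \<circ> Bs i) y)"
      using x y hilbert_operator.adjoint[OF opA[OF ij(2)]] hilbert_operator.adjoint[OF opB[OF ij(1)]]
      by (simp add: As_def Bs_def)
  qed (use ij in \<open>auto intro: comp_op A B As Bs\<close>)
  have w: "0 \<le> ?w" by (rule mat_numerical_radius_nonneg)
  have form: "(\<Sum>i<n. \<Sum>j<n. cmod (cinner (H i) (B i (A j (x j))) (x i))) \<le> ?w * (\<Sum>i<n. (cnorm (H i) (x i))\<^sup>2)"
    if x: "\<And>i. i < n \<Longrightarrow> x i \<in> carrier (H i)" for x
  proof -
    let ?v = "\<lambda>i. cnorm (H i) (x i)"
    have "(\<Sum>i<n. \<Sum>j<n. cmod (cinner (H i) (B i (A j (x j))) (x i)))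
        \<le> (\<Sum>i<n. \<Sum>j<n. gamma H A B i j * ?v i * ?v j)"
    proof (rule sum_square_split)
      fix i assume i: "i < n"
      have "hilbert_endomorphism (H i) (B i \<circ> A i)"
        unfolding hilbert_endomorphism_def by (rule comp_op[OF i i B A]) (fact i)+
      from hilbert_endomorphism.numerical_radius_bound[OF this x[OF i]]
      show "cmod (cinner (H i) (B i (A i (x i))) (x i)) \<le> gamma H A B i i * ?v i * ?v i"
        by (simp add: gamma_def power2_eq_square mult.assoc)
    next
      fix i j assume "i < j" and j: "j < n"
      then have i: "i < n" by simp
      \<comment> \<open>The first product \<open>B i \<circ> A j\<close> runs from
        \<open>H j\<close> to \<open>H i\<close>, so \<open>x j\<close> is the vector in its
        domain.\<close>
      from off_diagonal_bound[OF pair[OF i j] pair[OF j i] x[OF j] x[OF i]]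
      show "cmod (cinner (H i) (B i (A j (x j))) (x i)) + cmod (cinner (H j) (B j (A i (x i))) (x j))
          \<le> gamma H A B i j * ?v i * ?v j"
        using \<open>i < j\<close> by (simp add: gamma_def Let_def As_def Bs_def comp_assoc mult_ac)
    qed (simp add: gamma_def)
    also have "\<dots> \<le> ?w * (\<Sum>i<n. (?v i)\<^sup>2)" by (rule quadratic_form_le_mat_numerical_radius)
    finally show ?thesis .
  qed
  have form': "(\<Sum>i<n. \<Sum>j<n. cmod (cinner (H i) (As i (Bs j (x j))) (x i))) \<le> ?w * (\<Sum>i<n. (cnorm (H i) (x i))\<^sup>2)"
    if x: "\<And>i. i < n \<Longrightarrow> x i \<in> carrier (H i)" for x
  proof -
    have "cmod (cinner (H i) (As i (Bs j (x j))) (x i)) = cmod (cinner (H j) (B j (A i (x i))) (x j))"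
      if ij: "i < n" "j < n" for i j
    proof -
      interpret P: adjoint_pair "H i" "H j" "B j \<circ> A i" "As i \<circ> Bs j" by (rule pair[OF ij(2,1)])
      have "cinner (H i) (As i (Bs j (x j))) (x i) = cinner (H j) (x j) (B j (A i (x i)))"
        using P.adjoint_eq'[of "x i" "x j"] x ij by simp
      also have "\<dots> = cnj (cinner (H j) (B j (A i (x i))) (x j))"
        using P.T.closed[of "x i"] x ij by (intro P.T.K.cinner_commute) auto
      finally show ?thesis by simp
    qed
    then have "(\<Sum>i<n. \<Sum>j<n. cmod (cinner (H i) (As i (Bs j (x j))) (x i)))
        = (\<Sum>i<n. \<Sum>j<n. cmod (cinner (H j) (B j (A i (x i))) (x j)))"
      by (intro sum.cong refl) auto
    also have "\<dots> = (\<Sum>i<n. \<Sum>j<n. cmod (cinner (H i) (B i (A j (x j))) (x i)))" by (rule sum.swap)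
    also have "\<dots> \<le> ?w * (\<Sum>i<n. (cnorm (H i) (x i))\<^sup>2)" by (rule form[OF x])
    finally show ?thesis .
  qed
  have "cmod z \<le> ?w" if z: "z \<in> op_spectrum (H 0) ?S" for z
  proof (rule ccontr)
    assume "\<not> cmod z \<le> ?w"
    then have zw: "?w < cmod z" "?w < cmod (cnj z)" by simp_all
    let ?T = "\<lambda>x. ?S x \<ominus>\<^bsub>H 0\<^esub> z \<odot>\<^bsub>H 0\<^esub> x"
    have AB: "A i (B i x) \<in> carrier (H 0)" and BA: "Bs i (As i x) \<in> carrier (H 0)"
      if "i < n" "x \<in> carrier (H 0)" for i x
      using that bounded_opsD(1)[OF A] bounded_opsD(1)[OF B] bounded_opsD(1)[OF As] bounded_opsD(1)[OF Bs] by auto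
    have S_closed [simp]: "?S x \<in> carrier (H 0)" if "x \<in> carrier (H 0)" for x
      using that AB by (intro H0.finsum_closed) auto
    have "?S \<in> bounded_ops (H 0) (H 0)"
      using bounded_ops_comp[OF H0 H H0 B A] by (intro H0.bounded_ops_finsum H0) auto
    then have "(\<lambda>x. ?S x \<oplus>\<^bsub>H 0\<^esub> (- z) \<odot>\<^bsub>H 0\<^esub> x) \<in> bounded_ops (H 0) (H 0)"
      by (intro H0.bounded_ops_add H0.bounded_ops_smult H0 ident_bounded_op)
    then have "?T \<in> bounded_ops (H 0) (H 0)"
      by (rule H0.bounded_ops_cong[OF H0]) (intro H0.cinner_ext, simp_all)
    then interpret T: hilbert_endomorphism "H 0" ?T by unfold_locales
    obtain c where c: "0 < c" "\<And>x. x \<in> carrier (H 0) \<Longrightarrow> c * cnorm (H 0) x \<le> cnorm (H 0) (?T x)"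
      by (rule sum_op_bounded_below[OF H0 H A B form w zw(1)]) auto
    \<comment> \<open>The adjoint is again a sum of composites minus a scalar, with
      \<open>Bs i\<close> and \<open>As i\<close> in the places of \<open>A i\<close> and
      \<open>B i\<close> and a scalar of the same modulus. Hence \<open>sum_op_bounded_below\<close>
      applies once more, now with \<open>form'\<close>.\<close>
    have T': "T.T' x = (\<Oplus>\<^bsub>H 0\<^esub>i\<in>{..<n}. Bs i (As i x)) \<ominus>\<^bsub>H 0\<^esub> cnj z \<odot>\<^bsub>H 0\<^esub> x"
      if x: "x \<in> carrier (H 0)" for x
    proof (rule H0.cinner_ext)
      have closed: "(\<Oplus>\<^bsub>H 0\<^esub>i\<in>{..<n}. Bs i (As i x)) \<in> carrier (H 0)"
        using x BA by (intro H0.finsum_closed) auto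
      then show "(\<Oplus>\<^bsub>H 0\<^esub>i\<in>{..<n}. Bs i (As i x)) \<ominus>\<^bsub>H 0\<^esub> cnj z \<odot>\<^bsub>H 0\<^esub> x \<in> carrier (H 0)"
        using x by simp
      fix y assume y: "y \<in> carrier (H 0)"
      have eq: "cinner (H 0) (A i (B i y)) x = cinner (H 0) y (Bs i (As i x))" if i: "i < n" for i
        using hilbert_operator.adjoint[OF opA[OF i] x] hilbert_operator.adjoint[OF opB[OF i] _ y]
          bounded_opsD(1)[OF B[OF i] y] bounded_opsD(1)[OF As[OF i] x]
        by (simp add: As_def Bs_def)
      have "cinner (H 0) (?S y) x = (\<Sum>i<n. cinner (H 0) (A i (B i y)) x)"
        using x y AB by (intro H0.cinner_finsum_left) auto
      also have "\<dots> = (\<Sum>i<n. cinner (H 0) y (Bs i (As i x)))" by (simp add: eq)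
      also have "\<dots> = cinner (H 0) y (\<Oplus>\<^bsub>H 0\<^esub>i\<in>{..<n}. Bs i (As i x))"
        using x y BA by (intro H0.cinner_finsum_right[symmetric]) auto
      finally show "cinner (H 0) y (T.T' x)
          = cinner (H 0) y ((\<Oplus>\<^bsub>H 0\<^esub>i\<in>{..<n}. Bs i (As i x)) \<ominus>\<^bsub>H 0\<^esub> cnj z \<odot>\<^bsub>H 0\<^esub> x)"
        using x y closed by (simp add: T.adjoint[symmetric])
    qed (use x in simp)
    obtain c' where c': "0 < c'" "\<And>x. x \<in> carrier (H 0) \<Longrightarrow> c' * cnorm (H 0) x \<le> cnorm (H 0) (T.T' x)"
      by (rule sum_op_bounded_below[OF H0 H Bs As form' w zw(2)]) (auto simp: T')
    \<comment> \<open>\<open>invertible\<close> asks for one constant below both operators.\<close>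
    define k where "k = min c c'"
    have k: "0 < k" "k \<le> c" "k \<le> c'" using c(1) c'(1) by (simp_all add: k_def)
    have k_T: "k * cnorm (H 0) x \<le> cnorm (H 0) (?T x)" if "x \<in> carrier (H 0)" for x
      using mult_right_mono[OF k(2) H0.cnorm_nonneg[OF that]] c(2)[OF that] by (rule order_trans)
    have k_T': "k * cnorm (H 0) x \<le> cnorm (H 0) (T.T' x)" if "x \<in> carrier (H 0)" for x
      using mult_right_mono[OF k(3) H0.cnorm_nonneg[OF that]] c'(2)[OF that] by (rule order_trans)
    show False
    proof (rule T.invertible[OF k(1) k_T k_T'])
      fix G assume "G \<in> bounded_ops (H 0) (H 0)"
        "\<And>x. x \<in> carrier (H 0) \<Longrightarrow> G (?T x) = x" "\<And>x. x \<in> carrier (H 0) \<Longrightarrow> ?T (G x) = x"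
      then show False using z unfolding op_spectrum_def by blast
    qed
  qed
  \<comment> \<open>The 0 inserted in the supremum keeps the set nonempty and is covered by
    \<open>w\<close>.\<close>
  then show ?thesis
    unfolding op_spectral_radius_def using w by (intro cSup_least) auto
qed

end
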